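(* Setting: $Y_i=f_0(X_i)+\epsilon_i$, $i=1,\dots,n$, with $X_i$ i.i.d. from $P$ on a compact $\mathcal{X}\subset\mathbb{R}^d$, $\epsilon_i$ i.i.d. with $E[\epsilon]=0$ and $\int_0^\infty(\mathbb{P}(|\epsilon|>t))^{1/p}dt<\infty$ for some $p\ge2$. Let $r_n,V_n,M_n\to\infty$ with $V_n>1$, $M_n>0$, and $$\mathcal{F}_{r_n}=\Big\{\alpha_0+\sum_{j=1}^{r_n}\alpha_j\tanh(\gamma_j^Tx+\gamma_{0,j}):\gamma_j\in\mathbb{R}^d,\ \alpha_j,\gamma_{0,j}\in\mathbb{R},\ \sum_{j=0}^{r_n}|\alpha_j|\le V_n,\ \max_{1\le j\le r_n}\sum_{i=0}^d|\gamma_{i,j}|\le M_n\Big\},$$ with $\gamma_{i,j}$ ($1\le i\le d$) the components of $\gamma_j$. Assume $\mathcal{F}_{r_n}\subset\mathcal{F}_{r_{n+1}}$, $f_0\in\mathcal{F}$ and there is $\pi_nf_0\in\mathcal{F}_{r_n}$ with $\sup_{x\in\mathcal{X}}|\pi_nf_0(x)-f_0(x)|\to0$. Let $J_n(f)=\sum_{j=0}^{r_n}|\alpha_j|+\sum_{i=0}^d\sum_{j=1}^{r_n}|\gamma_{i,j}|$ and let $\hat f_n\in\mathcal{F}_{r_n}$ satisfy $\tilde{\mathbb{Q}}_n(\hat f_n)\le\inf_{f\in\mathcal{F}_{r_n}}\tilde{\mathbb{Q}}_n(f)+O(\eta_n)$ with $\eta_n\to0$, where $\tilde{\mathbb{Q}}_n(f)=\frac1n\sum_{i=1}^n(f(X_i)-Y_i)^2+\lambda_nJ_n(f)$.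 Assume $$r_nV_n^2\log(r_nV_n)=o(n)\quad\text{as }n\to\infty.$$ Then for any $\delta>0$ there exists $\nu>0$ such that, if $\lambda_n=o\big(r_n^{-1/2}\wedge r_n^{-(\nu-1)/(2\nu)}\big)$, then $\|\hat f_n-f_0\|_n\to0$ as $n\to\infty$ with probability at least $1-\delta$.
   Context: $\|g\|_n^2=\frac1n\sum_{i=1}^ng(X_i)^2$ is the empirical norm; $a\wedge b=\min(a,b)$.
   Formalization: The errors ε_i are assumed independent of the design points X_i (all X_i, ε_i mutually independent), without which the claim fails (e.g. ε_i = X_i with X_i symmetric); the penalty parameter is taken with λ_n ≥ 0. *)

theory Defs
  imports "HOL-Probability.Probability" "HOL-Library.Landau_Symbols"
begin

text \<open>Network parameters: output weights alpha (index 0 = intercept alpha_0),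
  input weights gamma_j in R^d, biases gamma_{0,j}.\<close>
type_synonym 'd nnparam = "(nat \<Rightarrow> real) \<times> (nat \<Rightarrow> real^'d) \<times> (nat \<Rightarrow> real)"

definition net :: "nat \<Rightarrow> 'd::finite nnparam \<Rightarrow> real^'d \<Rightarrow> real" where
  "net r \<theta> x = (case \<theta> of (\<alpha>, \<gamma>, \<gamma>0) \<Rightarrow>
      \<alpha> 0 + (\<Sum>j=1..r. \<alpha> j * tanh (inner (\<gamma> j) x + \<gamma>0 j)))"

definition Theta :: "nat \<Rightarrow> real \<Rightarrow> real \<Rightarrow> 'd::finite nnparam set" where
  "Theta r V M = {(\<alpha>, \<gamma>, \<gamma>0). (\<Sum>j\<le>r. \<bar>\<alpha> j\<bar>) \<le> V \<and>
      (\<forall>j\<in>{1..r}. \<bar>\<gamma>0 j\<bar> + (\<Sum>i\<in>UNIV. \<bar>\<gamma> j $ i\<bar>) \<le> M)}"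

definition Fclass :: "nat \<Rightarrow> real \<Rightarrow> real \<Rightarrow> (real^'d::finite \<Rightarrow> real) set" where
  "Fclass r V M = net r ` Theta r V M"

definition Jpen :: "nat \<Rightarrow> 'd::finite nnparam \<Rightarrow> real" where
  "Jpen r \<theta> = (case \<theta> of (\<alpha>, \<gamma>, \<gamma>0) \<Rightarrow>
      (\<Sum>j\<le>r. \<bar>\<alpha> j\<bar>) + (\<Sum>j=1..r. \<bar>\<gamma>0 j\<bar> + (\<Sum>i\<in>UNIV. \<bar>\<gamma> j $ i\<bar>)))"

definition emp_norm :: "nat \<Rightarrow> (nat \<Rightarrow> 'x) \<Rightarrow> ('x \<Rightarrow> real) \<Rightarrow> real" where
  "emp_norm n xs g = sqrt ((1 / real n) * (\<Sum>i<n. (g (xs i))^2))"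

definition Qpen :: "nat \<Rightarrow> nat \<Rightarrow> real \<Rightarrow> (nat \<Rightarrow> real^'d::finite) \<Rightarrow> (nat \<Rightarrow> real)
     \<Rightarrow> 'd nnparam \<Rightarrow> real" where
  "Qpen n r lam xs ys \<theta> =
     (1 / real n) * (\<Sum>i<n. (net r \<theta> (xs i) - ys i)^2) + lam * Jpen r \<theta>"

end

theory Submission
  imports Defs "HOL-Real_Asymp.Real_Asymp"
begin

text \<open>
  Since \<open>(\<nu> - 1) / (2 * \<nu>) < 1 / 2\<close> for every \<open>\<nu> > 0\<close>, the condition on the penalty always reads
  \<open>lam = o(r powr (-1/2))\<close>, and all that matters is \<open>lam \<longlonglongrightarrow> 0\<close>: a fixed approximant of \<open>f0\<close>, padded with
  zero neurons, has a penalty that does not depend on \<open>n\<close>. Comparing the estimator with this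
  approximant reduces the claim to \<open>sup |\<Sum>i<n. eps i * f (X i)| = o(n)\<close> almost surely, with \<open>f\<close> ranging
  over the network class.

  The \<open>l1\<close>-bound \<open>V n\<close> on the output weights reduces this to a single neuron, and \<open>tanh\<close> is
  an average of indicators of half-lines, so only the sums of the noise over half-spaces matter,
  whatever \<open>Mn\<close> is. By Radon's theorem and Pajor's form of the Sauer-Shelah lemma, \<open>n\<close> points
  of dimension \<open>d\<close> have at most \<open>(n + 1) ^ (d + 1)\<close> traces on half-spaces. As the noise is independent of
  the design and has a finite second moment, truncation, Bernstein's inequality and
  Borel-Cantelli bound these sums by a multiple of \<open>sqrt (n * ln n)\<close> almost surely. The rate
  condition gives \<open>V n * sqrt (n * ln n) = o(n)\<close>: either \<open>V n ^ 4 \<le> n\<close>, or \<open>ln n \<le> 4 * ln (V n)\<close>.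
\<close>

section \<open>Traces of half-spaces on finite point sets\<close>

definition shattered :: "'a set set \<Rightarrow> 'a set set" where
  "shattered F = {T. \<forall>B\<subseteq>T. \<exists>A\<in>F. A \<inter> T = B}"

lemma finite_shattered:
  assumes "finite F" "\<And>A. A \<in> F \<Longrightarrow> finite A"
  shows "finite (shattered F)"
proof (rule finite_subset)
  show "shattered F \<subseteq> (\<Union>A\<in>F. Pow A)"
  proof
    fix T assume "T \<in> shattered F"
    then have "\<forall>B\<subseteq>T. \<exists>A\<in>F. A \<inter> T = B"
      by (simp add: shattered_def)
    from this[rule_format, OF order_refl] obtain A where "A \<in> F" "A \<inter> T = T"
      by blast
    then show "T \<in> (\<Union>A\<in>F. Pow A)" by blast
  qed
qed (use assms in auto)

text \<open>Pajor's inequality, by induction on \<open>card F\<close>. Split \<open>F\<close> into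
  \<open>F1\<close> and \<open>F0\<close> by a point \<open>x\<close> on which its members disagree.
  Neither half shatters a set containing \<open>x\<close>, and each \<open>T\<close> shattered by
  both makes \<open>insert x T\<close> shattered by \<open>F\<close>; these extra sets pay for the
  overlap. Without such an \<open>x\<close> there is at most one member, and a single member
  shatters \<open>{}\<close>.\<close>

lemma card_le_card_shattered:
  assumes "finite F" "\<And>A. A \<in> F \<Longrightarrow> finite A"
  shows "card F \<le> card (shattered F)"
  using assms
proof (induction "card F" arbitrary: F rule: less_induct)
  case less
  note fin = less.prems
  show ?case
  proof (cases "\<exists>x. (\<exists>A\<in>F. x \<in> A) \<and> (\<exists>A\<in>F. x \<notin> A)")
    case False
    then have eq: "A = B" if "A \<in> F" "B \<in> F" for A B
      using that by blast
    show ?thesis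
    proof (cases "F = {}")
      case False
      then obtain A where "A \<in> F" by blast
      with eq have "F = {A}" by blast
      moreover have "{} \<in> shattered F"
        using \<open>A \<in> F\<close> by (auto simp: shattered_def)
      ultimately show ?thesis
        using finite_shattered[OF fin] card_gt_0_iff[of "shattered F"]
        by (auto simp: Suc_le_eq)
    qed simp
  next
    case True
    then obtain x A1 A0 where x: "A1 \<in> F" "x \<in> A1" "A0 \<in> F" "x \<notin> A0" by blast
    define F1 F0 where "F1 = {A\<in>F. x \<in> A}" and "F0 = {A\<in>F. x \<notin> A}"
    have F: "F = F1 \<union> F0" "F1 \<inter> F0 = {}" and fF: "finite F1" "finite F0"
      using fin by (auto simp: F1_def F0_def)
    have "F1 \<subset> F" "F0 \<subset> F"
      using x by (auto simp: F1_def F0_def)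
    then have lt: "card F1 < card F" "card F0 < card F"
      using fin(1) by (auto intro: psubset_card_mono)
    have fA: "finite A" if "A \<in> F1 \<or> A \<in> F0" for A
      using that fin by (auto simp: F1_def F0_def)
    have IH: "card F1 \<le> card (shattered F1)" "card F0 \<le> card (shattered F0)"
      using less.hyps lt fF fA by blast+
    have notin: "x \<notin> T" if "T \<in> shattered F1 \<or> T \<in> shattered F0" for T
    proof
      assume "x \<in> T"
      from that show False
      proof
        assume "T \<in> shattered F1"
        moreover have "T - {x} \<subseteq> T" by blast
        ultimately obtain A where "A \<in> F1" "A \<inter> T = T - {x}"
          unfolding shattered_def by blast
        with \<open>x \<in> T\<close> show False by (auto simp: F1_def)
      next
        assume "T \<in> shattered F0"
        then obtain A where "A \<in> F0" "A \<inter> T = T"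
          unfolding shattered_def by blast
        with \<open>x \<in> T\<close> show False by (auto simp: F0_def)
      qed
    qed
    let ?U = "shattered F1 \<union> shattered F0" and ?I = "shattered F1 \<inter> shattered F0"
    have fs: "finite (shattered F1)" "finite (shattered F0)"
      using finite_shattered fF fA by blast+
    \<comment> \<open>A subset of \<open>insert x T\<close> that contains \<open>x\<close> is cut
      out by a member of \<open>F1\<close>, any other subset by a member of
      \<open>F0\<close>.\<close>
    have ins: "insert x T \<in> shattered F" if "T \<in> ?I" for T
      unfolding shattered_def
    proof (intro CollectI allI impI)
      fix B assume B: "B \<subseteq> insert x T"
      have TI: "T \<in> shattered F1" "T \<in> shattered F0"
        using that by blast+
      show "\<exists>A\<in>F. A \<inter> insert x T = B"
      proof (cases "x \<in> B")
        case True
        have "B - {x} \<subseteq> T" using B by blast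
        then obtain A where "A \<in> F1" "A \<inter> T = B - {x}"
          using TI unfolding shattered_def by blast
        then show ?thesis
          using True by (intro bexI[of _ A]) (auto simp: F1_def)
      next
        case False
        then have "B \<subseteq> T" using B by blast
        then obtain A where "A \<in> F0" "A \<inter> T = B"
          using TI unfolding shattered_def by blast
        then show ?thesis
          using False by (intro bexI[of _ A]) (auto simp: F0_def)
      qed
    qed
    have "?U \<subseteq> shattered F"
      unfolding shattered_def F1_def F0_def by blast
    then have sub: "?U \<union> insert x ` ?I \<subseteq> shattered F"
      using ins by blast
    have inj: "inj_on (insert x) ?I"
      using notin by (intro inj_onI) (metis IntD1 insert_ident)
    have disj: "?U \<inter> insert x ` ?I = {}"
      using notin by blast
    have "card F = card F1 + card F0"
      using F fF by (simp add: card_Un_disjoint)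
    also have "\<dots> \<le> card (shattered F1) + card (shattered F0)"
      using IH by simp
    also have "\<dots> = card ?U + card ?I"
      using fs by (rule card_Un_Int)
    also have "\<dots> = card (?U \<union> insert x ` ?I)"
      using fs disj by (simp add: card_Un_disjoint card_image[OF inj])
    also have "\<dots> \<le> card (shattered F)"
      using sub finite_shattered[OF fin] by (intro card_mono) auto
    finally show ?thesis .
  qed
qed

text \<open>A set of at most \<open>k\<close> numbers below \<open>n\<close> is coded as a word of
  length \<open>k\<close> over the \<open>n + 1\<close> letters \<open>{..n}\<close>; the spare
  letter \<open>n\<close> is padding, erased again by the intersection with
  \<open>{..<n}\<close>.\<close>

lemma card_subsets_card_le:
  "card {T. T \<subseteq> {..<n} \<and> card T \<le> k} \<le> (n + 1) ^ k"
proof -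
  let ?L = "{xs. set xs \<subseteq> {..n} \<and> length xs = k}"
  have "{T. T \<subseteq> {..<n} \<and> card T \<le> k} \<subseteq> (\<lambda>xs. set xs \<inter> {..<n}) ` ?L"
  proof safe
    fix T assume T: "T \<subseteq> {..<n}" "card T \<le> k"
    then have fT: "finite T" using finite_subset by blast
    let ?xs = "sorted_list_of_set T @ replicate (k - card T) n"
    have "?xs \<in> ?L" "T = set ?xs \<inter> {..<n}"
      using T fT by (auto simp: set_replicate_conv_if)
    then show "T \<in> (\<lambda>xs. set xs \<inter> {..<n}) ` ?L" by blast
  qed
  then have "card {T. T \<subseteq> {..<n} \<and> card T \<le> k} \<le> card ((\<lambda>xs. set xs \<inter> {..<n}) ` ?L)"
    by (intro card_mono finite_imageI finite_lists_length_eq) auto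
  also have "\<dots> \<le> card ?L"
    by (intro card_image_le finite_lists_length_eq) auto
  also have "\<dots> = (n + 1) ^ k"
    by (simp add: card_lists_length_eq)
  finally show ?thesis .
qed

text \<open>The inequality is required to be strict on both sides: the condition is then open in
  \<open>(\<gamma>, c)\<close> and hence measurable in the points \<open>x\<close>.\<close>

definition halfspace_cuts :: "nat \<Rightarrow> (nat \<Rightarrow> 'b::real_inner) \<Rightarrow> nat set set" where
  "halfspace_cuts n x = {S. S \<subseteq> {..<n} \<and>
     (\<exists>\<gamma> c. (\<forall>i\<in>S. c < \<gamma> \<bullet> x i) \<and> (\<forall>i\<in>{..<n} - S. \<gamma> \<bullet> x i < c))}"

text \<open>Points with \<open>\<gamma> \<bullet> x i = c\<close> violate strictness on the outer
  side. Raising the threshold slightly, to a value below all selected inner products, keeps the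
  trace and makes both sides strict.\<close>

lemma halfspace_cut: "{i\<in>{..<n}. c < \<gamma> \<bullet> x i} \<in> halfspace_cuts n x"
proof -
  let ?S = "{i\<in>{..<n}. c < \<gamma> \<bullet> x i}"
  obtain c' where c': "c < c'" "\<forall>i\<in>?S. c' < \<gamma> \<bullet> x i"
  proof (cases "?S = {}")
    case True
    then show thesis using that[of "c + 1"] by auto
  next
    case False
    let ?m = "Min ((\<lambda>i. \<gamma> \<bullet> x i) ` ?S)"
    have "c < ?m" using False by simp
    then obtain c' where "c < c'" "c' < ?m" using dense by blast
    moreover have "\<forall>i\<in>?S. ?m \<le> \<gamma> \<bullet> x i" by simp
    ultimately show thesis using that[of c'] by (meson less_le_trans)
  qed
  then show ?thesis
    unfolding halfspace_cuts_def by (intro CollectI conjI exI[of _ \<gamma>] exI[of _ c']) auto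
qed

text \<open>The Vapnik-Chervonenkis dimension of half-spaces. More than \<open>DIM('b) + 1\<close>
  points are affinely dependent, so Radon's theorem splits them into two parts with intersecting
  convex hulls; a half-space realising this split would put a common point strictly on both
  sides.\<close>

lemma card_shattered_halfspace_cuts:
  fixes x :: "nat \<Rightarrow> 'b::euclidean_space"
  assumes T: "T \<in> shattered (halfspace_cuts n x)"
  shows "T \<subseteq> {..<n}" "card T \<le> DIM('b) + 1"
proof -
  show Tn: "T \<subseteq> {..<n}"
    using T unfolding shattered_def halfspace_cuts_def by blast
  then have fT: "finite T" using finite_subset by blast
  have sep: "\<exists>\<gamma> c. (\<forall>i\<in>B. c < \<gamma> \<bullet> x i) \<and> (\<forall>i\<in>T - B. \<gamma> \<bullet> x i < c)" if B: "B \<subseteq> T" for B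
  proof -
    obtain A where A: "A \<in> halfspace_cuts n x" "A \<inter> T = B"
      using T B unfolding shattered_def by blast
    then obtain \<gamma> c where "\<forall>i\<in>A. c < \<gamma> \<bullet> x i" "\<forall>i\<in>{..<n} - A. \<gamma> \<bullet> x i < c"
      unfolding halfspace_cuts_def by blast
    then show ?thesis using A(2) Tn by blast
  qed
  \<comment> \<open>Radon's theorem counts points, while \<open>T\<close> counts indices. Coinciding
    points cannot be separated, so \<open>x\<close> is injective on a shattered
    \<open>T\<close>.\<close>
  have inj: "inj_on x T"
  proof (rule inj_onI, rule ccontr)
    fix i j assume ij: "i \<in> T" "j \<in> T" "x i = x j" "i \<noteq> j"
    then show False using sep[of "{i}"] by force
  qed
  show "card T \<le> DIM('b) + 1"
  proof (rule ccontr)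
    assume "\<not> ?thesis"
    then have "affine_dependent (x ` T)"
      using fT by (intro affine_dependent_biggerset) (auto simp: card_image[OF inj])
    then obtain A B where AB: "A \<inter> B = {}" "A \<union> B = x ` T" "convex hull A \<inter> convex hull B \<noteq> {}"
      using Radon_partition[of "x ` T"] fT by blast
    then obtain z where z: "z \<in> convex hull A" "z \<in> convex hull B" by blast
    obtain \<gamma> c where g: "\<forall>i\<in>{i\<in>T. x i \<in> A}. c < \<gamma> \<bullet> x i" "\<forall>i\<in>T - {i\<in>T. x i \<in> A}. \<gamma> \<bullet> x i < c"
      using sep[of "{i\<in>T. x i \<in> A}"] by blast
    have "A \<subseteq> {y. \<gamma> \<bullet> y > c}"
    proof
      fix y assume "y \<in> A"
      then obtain i where "i \<in> T" "y = x i" using AB(2) by blast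
      then show "y \<in> {y. \<gamma> \<bullet> y > c}" using g(1) \<open>y \<in> A\<close> by blast
    qed
    then have "convex hull A \<subseteq> {y. \<gamma> \<bullet> y > c}"
      by (intro hull_minimal convex_halfspace_gt)
    moreover have "B \<subseteq> {y. \<gamma> \<bullet> y < c}"
    proof
      fix y assume "y \<in> B"
      then obtain i where "i \<in> T" "y = x i" using AB(2) by blast
      moreover have "y \<notin> A" using AB(1) \<open>y \<in> B\<close> by blast
      ultimately show "y \<in> {y. \<gamma> \<bullet> y < c}" using g(2) by blast
    qed
    then have "convex hull B \<subseteq> {y. \<gamma> \<bullet> y < c}"
      by (intro hull_minimal convex_halfspace_lt)
    ultimately show False using z by fastforce
  qed
qed

lemma card_halfspace_cuts:
  fixes x :: "nat \<Rightarrow> 'b::euclidean_space"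
  shows "finite (halfspace_cuts n x)" "card (halfspace_cuts n x) \<le> (n + 1) ^ (DIM('b) + 1)"
proof -
  have sub: "halfspace_cuts n x \<subseteq> Pow {..<n}"
    unfolding halfspace_cuts_def by blast
  then show fin: "finite (halfspace_cuts n x)"
    using finite_subset by blast
  have "card (halfspace_cuts n x) \<le> card (shattered (halfspace_cuts n x))"
    using sub finite_subset by (intro card_le_card_shattered fin) blast
  also have "\<dots> \<le> card {T. T \<subseteq> {..<n} \<and> card T \<le> DIM('b) + 1}"
    using card_shattered_halfspace_cuts by (intro card_mono) auto
  also have "\<dots> \<le> (n + 1) ^ (DIM('b) + 1)"
    by (rule card_subsets_card_le)
  finally show "card (halfspace_cuts n x) \<le> (n + 1) ^ (DIM('b) + 1)" .
qed

text \<open>The definition quantifies over uncountably many pairs \<open>(\<gamma>, c)\<close>. For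
  a fixed design the pairs that realise \<open>S\<close> form an open set, which meets a countable
  dense set as soon as it is nonempty; the event is thus a countable union of measurable
  ones.\<close>

lemma pred_halfspace_cuts [measurable]:
  fixes X :: "nat \<Rightarrow> 'a \<Rightarrow> 'b::euclidean_space"
  assumes [measurable]: "\<And>i. i < n \<Longrightarrow> X i \<in> borel_measurable M"
  shows "Measurable.pred M (\<lambda>\<omega>. S \<in> halfspace_cuts n (\<lambda>i. X i \<omega>))"
proof (cases "S \<subseteq> {..<n}")
  case False
  then show ?thesis by (simp add: halfspace_cuts_def)
next
  case True
  obtain D :: "('b \<times> real) set" where D: "countable D" "\<And>U. open U \<Longrightarrow> U \<noteq> {} \<Longrightarrow> \<exists>d\<in>D. d \<in> U"
    using countable_dense_exists by blast
  let ?Q = "\<lambda>x d. (\<forall>i\<in>S. snd d < fst d \<bullet> x i) \<and> (\<forall>i\<in>{..<n} - S. fst d \<bullet> x i < (snd d :: real))"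
  have "S \<in> halfspace_cuts n x \<longleftrightarrow> (\<exists>d\<in>D. ?Q x d)" for x :: "nat \<Rightarrow> 'b"
  proof
    assume "S \<in> halfspace_cuts n x"
    then obtain d where "?Q x d" unfolding halfspace_cuts_def by force
    then have ne: "{d. ?Q x d} \<noteq> {}" by blast
    have "{d. ?Q x d} = (\<Inter>i\<in>S. {d. snd d < fst d \<bullet> x i}) \<inter> (\<Inter>i\<in>{..<n} - S. {d. fst d \<bullet> x i < snd d})"
      by auto
    also have "open \<dots>"
      using finite_subset[OF True]
      by (intro open_Int open_INT ballI open_Collect_less continuous_intros) auto
    finally show "\<exists>d\<in>D. ?Q x d" using D(2)[of "{d. ?Q x d}"] ne by blast
  next
    assume "\<exists>d\<in>D. ?Q x d"
    then show "S \<in> halfspace_cuts n x" using True unfolding halfspace_cuts_def by blast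
  qed
  moreover have "Measurable.pred M (\<lambda>\<omega>. \<exists>d\<in>D. ?Q (\<lambda>i. X i \<omega>) d)"
    unfolding pred_def
  proof (rule sets.sets_Collect_countable_Ex'[OF _ D(1)])
    fix d
    have fS: "finite S" using finite_subset[OF True] by simp
    have "Measurable.pred M (\<lambda>\<omega>. \<forall>i\<in>S. snd d < fst d \<bullet> X i \<omega>)"
    proof (rule pred_intros_finite(3)[OF fS])
      fix i assume "i \<in> S"
      then have [measurable]: "X i \<in> borel_measurable M" using True by auto
      show "Measurable.pred M (\<lambda>\<omega>. snd d < fst d \<bullet> X i \<omega>)" by measurable
    qed
    moreover have "Measurable.pred M (\<lambda>\<omega>. \<forall>i\<in>{..<n} - S. fst d \<bullet> X i \<omega> < snd d)"
    proof (rule pred_intros_finite(3))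
      fix i assume "i \<in> {..<n} - S"
      then have [measurable]: "X i \<in> borel_measurable M" by auto
      show "Measurable.pred M (\<lambda>\<omega>. fst d \<bullet> X i \<omega> < snd d)" by measurable
    qed simp
    ultimately show "{\<omega> \<in> space M. ?Q (\<lambda>i. X i \<omega>) d} \<in> sets M"
      unfolding pred_def by (auto intro: sets.sets_Collect_conj)
  qed
  ultimately show ?thesis by simp
qed

section \<open>Exponential inequality over half-spaces\<close>

text \<open>For \<open>u < 0\<close> and \<open>x = - u\<close> the claim is
  \<open>1 \<le> (1 - x + x^2) * exp x\<close>. Replacing \<open>exp x\<close> by its quadratic
  Taylor polynomial already gives \<open>1 + x^2 / 2 + x^3 / 2 + x^4 / 2\<close> on the
  right.\<close>

lemma exp_le_quadratic:
  fixes u :: real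
  assumes "\<bar>u\<bar> \<le> 1"
  shows "exp u \<le> 1 + u + u\<^sup>2"
proof (cases "u \<ge> 0")
  case True
  then show ?thesis using exp_bound assms by simp
next
  case False
  define x where "x = - u"
  have x: "0 \<le> x" using False by (simp add: x_def)
  have q: "1 + x + x\<^sup>2 / 2 \<le> exp x"
    using exp_lower_Taylor_quadratic[OF x] by simp
  have "1 \<le> 1 + x\<^sup>2 / 2 + x ^ 3 / 2 + x ^ 4 / 2" using x by simp
  also have "\<dots> = (1 - x + x\<^sup>2) * (1 + x + x\<^sup>2 / 2)"
    by (simp add: field_simps power2_eq_square power3_eq_cube power4_eq_xxxx)
  also have "\<dots> \<le> (1 - x + x\<^sup>2) * exp x"
  proof (rule mult_left_mono[OF q])
    have "1 - x + x\<^sup>2 = (x - 1/2)\<^sup>2 + 3/4"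
      by (simp add: power2_eq_square algebra_simps)
    then show "0 \<le> 1 - x + x\<^sup>2" by simp
  qed
  finally have "exp (- x) \<le> 1 - x + x\<^sup>2"
    by (simp add: exp_minus field_simps)
  then show ?thesis by (simp add: x_def)
qed

context prob_space
begin

text \<open>Independence across \<open>i\<close> and a product law for each pair make all single
  components independent, so that design and noise can later be treated as two independent blocks. A
  family in \<open>indep_vars\<close> needs a common value type: both kinds are embedded in the
  product space, padded with 0, and a boolean index tells them apart.\<close>

lemma indep_vars_components:
  fixes X :: "'i \<Rightarrow> 'a \<Rightarrow> 'b::euclidean_space" and Y :: "'i \<Rightarrow> 'a \<Rightarrow> 'c::euclidean_space"
  assumes I: "finite I"
    and indep: "indep_vars (\<lambda>_. borel) (\<lambda>i \<omega>. (X i \<omega>, Y i \<omega>)) I"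
    and X: "\<And>i. i \<in> I \<Longrightarrow> random_variable borel (X i)"
    and Y: "\<And>i. i \<in> I \<Longrightarrow> random_variable borel (Y i)"
    and XY: "\<And>i. i \<in> I \<Longrightarrow>
      distr M borel (\<lambda>\<omega>. (X i \<omega>, Y i \<omega>)) = distr M borel (X i) \<Otimes>\<^sub>M distr M borel (Y i)"
  shows "indep_vars (\<lambda>_. borel) (\<lambda>(i, b) \<omega>. if b then (X i \<omega>, 0) else (0, Y i \<omega>)) (I \<times> UNIV)"
    (is "indep_vars _ ?Z _")
proof (cases "I = {}")
  case True
  then show ?thesis by (simp add: indep_vars_def indep_sets_def)
next
  case False
  have Z: "random_variable borel (?Z j)" if "j \<in> I \<times> UNIV" for j
    using that X Y by (cases j) (auto intro!: borel_measurable_Pair)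
  have eq: "indep_vars (\<lambda>_. borel) ?Z (I \<times> UNIV) \<longleftrightarrow>
    (\<forall>A\<in>(I \<times> UNIV) \<rightarrow> sets borel. prob (\<Inter>j\<in>I \<times> UNIV. ?Z j -` A j \<inter> space M) =
       (\<Prod>j\<in>I \<times> UNIV. prob (?Z j -` A j \<inter> space M)))"
    using False I Z
    by (intro indep_vars_finite)
       (auto simp: sets.sigma_sets_eq[where M=borel, simplified] Int_stable_def)
  show ?thesis
    unfolding eq
  proof
    fix A :: "'i \<times> bool \<Rightarrow> ('b \<times> 'c) set"
    assume A: "A \<in> (I \<times> UNIV) \<rightarrow> sets borel"
    \<comment> \<open>The sections of \<open>A\<close> along the two embeddings turn the event into
      one rectangle per index \<open>i\<close>; independence of the pairs separates the indices, and
      the product law then separates the two sides of each rectangle.\<close>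
    define A1 where "A1 = (\<lambda>i. {x. (x, 0) \<in> A (i, True)})"
    define A0 where "A0 = (\<lambda>i. {y. (0, y) \<in> A (i, False)})"
    have A1: "A1 i \<in> sets borel" if "i \<in> I" for i
    proof -
      have "(\<lambda>x. (x, 0)) -` A (i, True) \<inter> space borel \<in> sets (borel :: 'b measure)"
        using A that by (intro measurable_sets[where A=borel]) (auto intro!: borel_measurable_Pair)
      then show ?thesis by (simp add: A1_def vimage_def)
    qed
    have A0: "A0 i \<in> sets borel" if "i \<in> I" for i
    proof -
      have "(\<lambda>x. (0, x)) -` A (i, False) \<inter> space borel \<in> sets (borel :: 'c measure)"
        using A that by (intro measurable_sets[where A=borel]) (auto intro!: borel_measurable_Pair)
      then show ?thesis by (simp add: A0_def vimage_def)
    qed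
    have "(\<Inter>j\<in>I \<times> UNIV. ?Z j -` A j \<inter> space M)
        = (\<Inter>i\<in>I. (\<lambda>\<omega>. (X i \<omega>, Y i \<omega>)) -` (A1 i \<times> A0 i) \<inter> space M)" (is "?l = ?r")
    proof (rule set_eqI)
      fix \<omega>
      have "\<omega> \<in> ?l \<longleftrightarrow> \<omega> \<in> space M \<and> (\<forall>i\<in>I. \<forall>b. ?Z (i, b) \<omega> \<in> A (i, b))"
        using False by auto
      also have "\<dots> \<longleftrightarrow> \<omega> \<in> ?r"
        using False by (auto simp: A1_def A0_def all_bool_eq)
      finally show "\<omega> \<in> ?l \<longleftrightarrow> \<omega> \<in> ?r" .
    qed
    also have "prob \<dots> = (\<Prod>i\<in>I. prob ((\<lambda>\<omega>. (X i \<omega>, Y i \<omega>)) -` (A1 i \<times> A0 i) \<inter> space M))"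
      using A1 A0 False I by (intro indep_varsD_finite[OF indep]) (auto simp: borel_prod[symmetric])
    also have "\<dots> = (\<Prod>i\<in>I. \<Prod>b\<in>UNIV. prob (?Z (i, b) -` A (i, b) \<inter> space M))"
    proof (rule prod.cong)
      fix i assume i: "i \<in> I"
      interpret Yi: prob_space "distr M borel (Y i)"
        by (rule prob_space_distr[OF Y[OF i]])
      have XYi: "random_variable borel (\<lambda>\<omega>. (X i \<omega>, Y i \<omega>))"
        using X[OF i] Y[OF i] by (rule borel_measurable_Pair)
      have "A1 i \<times> A0 i \<in> sets borel"
        using A1[OF i] A0[OF i] by (auto simp: borel_prod[symmetric])
      then have "prob ((\<lambda>\<omega>. (X i \<omega>, Y i \<omega>)) -` (A1 i \<times> A0 i) \<inter> space M)
          = measure (distr M borel (\<lambda>\<omega>. (X i \<omega>, Y i \<omega>))) (A1 i \<times> A0 i)"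
        by (simp add: measure_distr[OF XYi])
      also have "\<dots> = measure (distr M borel (X i)) (A1 i) * measure (distr M borel (Y i)) (A0 i)"
        unfolding XY[OF i] using A1[OF i] A0[OF i]
        by (simp add: measure_def Yi.emeasure_pair_measure_Times enn2real_mult)
      also have "\<dots> = prob (X i -` A1 i \<inter> space M) * prob (Y i -` A0 i \<inter> space M)"
        using A1[OF i] A0[OF i] X[OF i] Y[OF i] by (simp add: measure_distr)
      finally show "prob ((\<lambda>\<omega>. (X i \<omega>, Y i \<omega>)) -` (A1 i \<times> A0 i) \<inter> space M)
          = (\<Prod>b\<in>UNIV. prob (?Z (i, b) -` A (i, b) \<inter> space M))"
        by (simp add: UNIV_bool A1_def A0_def vimage_def mult.commute)
    qed simp
    also have "\<dots> = (\<Prod>j\<in>I \<times> UNIV. prob (?Z j -` A j \<inter> space M))"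
      by (subst prod.cartesian_product) (auto intro!: prod.cong)
    finally show "prob (\<Inter>j\<in>I \<times> UNIV. ?Z j -` A j \<inter> space M)
        = (\<Prod>j\<in>I \<times> UNIV. prob (?Z j -` A j \<inter> space M))" .
  qed
qed

text \<open>Chernoff's method: as \<open>\<bar>s * Y i \<omega>\<bar> \<le> 1\<close>, the bound
  \<open>exp u \<le> 1 + u + u^2\<close> applies, the zero mean kills the linear term, and each
  exponential moment is at most \<open>exp (s^2 * v)\<close>. The parameter \<open>s\<close> stays
  free, since its later choice is dictated by the truncation level.\<close>

lemma Bernstein_upper_tail:
  fixes Y :: "'i \<Rightarrow> 'a \<Rightarrow> real" and b s t v :: real
  assumes I: "finite I" and indep: "indep_vars (\<lambda>_. borel) Y I"
    and mean: "\<And>i. i \<in> I \<Longrightarrow> expectation (Y i) = 0"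
    and bound: "\<And>i \<omega>. i \<in> I \<Longrightarrow> \<omega> \<in> space M \<Longrightarrow> \<bar>Y i \<omega>\<bar> \<le> b"
    and var: "\<And>i. i \<in> I \<Longrightarrow> expectation (\<lambda>\<omega>. (Y i \<omega>)\<^sup>2) \<le> v"
    and s: "0 < s" "s * b \<le> 1"
  shows "prob {\<omega>\<in>space M. t \<le> (\<Sum>i\<in>I. Y i \<omega>)} \<le> exp (- s * t + card I * s\<^sup>2 * v)"
proof -
  have Y[measurable]: "random_variable borel (Y i)" if "i \<in> I" for i
    using indep that by (auto simp: indep_vars_def)
  have sY: "\<bar>s * Y i \<omega>\<bar> \<le> 1" if "i \<in> I" "\<omega> \<in> space M" for i \<omega>
    using order_trans[OF mult_left_mono[OF bound[OF that], of s] s(2)] s(1) by (simp add: abs_mult)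
  have int: "integrable M (Y i)" "integrable M (\<lambda>\<omega>. (Y i \<omega>)\<^sup>2)" "integrable M (\<lambda>\<omega>. exp (s * Y i \<omega>))"
    if i: "i \<in> I" for i
  proof -
    have [measurable]: "random_variable borel (Y i)" using i by (rule Y)
    show "integrable M (Y i)"
      using bound i by (intro integrable_const_bound[of _ b]) auto
    have "(Y i \<omega>)\<^sup>2 \<le> b\<^sup>2" if "\<omega> \<in> space M" for \<omega>
      using power_mono[OF bound[OF i that], of 2] by simp
    then show "integrable M (\<lambda>\<omega>. (Y i \<omega>)\<^sup>2)"
      by (intro integrable_const_bound[of _ "b\<^sup>2"]) auto
    have "exp (s * Y i \<omega>) \<le> exp 1" if "\<omega> \<in> space M" for \<omega>
      using sY[OF i that] by (simp add: abs_le_iff)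
    then show "integrable M (\<lambda>\<omega>. exp (s * Y i \<omega>))"
      by (intro integrable_const_bound[of _ "exp 1"]) auto
  qed
  have mgf: "expectation (\<lambda>\<omega>. exp (s * Y i \<omega>)) \<le> exp (s\<^sup>2 * v)" if i: "i \<in> I" for i
  proof -
    have "expectation (\<lambda>\<omega>. exp (s * Y i \<omega>))
        \<le> expectation (\<lambda>\<omega>. 1 + s * Y i \<omega> + s\<^sup>2 * (Y i \<omega>)\<^sup>2)"
      using int[OF i] exp_le_quadratic[OF sY[OF i]]
      by (intro integral_mono) (auto simp: power_mult_distrib)
    also have "\<dots> = 1 + s\<^sup>2 * expectation (\<lambda>\<omega>. (Y i \<omega>)\<^sup>2)"
      using int[OF i] mean[OF i] by (simp add: prob_space)
    also have "\<dots> \<le> 1 + s\<^sup>2 * v"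
      using var[OF i] by (simp add: mult_left_mono)
    also have "\<dots> \<le> exp (s\<^sup>2 * v)" by (rule exp_ge_add_one_self)
    finally show ?thesis .
  qed
  have ind_exp: "indep_vars (\<lambda>_. borel) (\<lambda>i \<omega>. exp (s * Y i \<omega>)) I"
    by (rule indep_vars_compose2[OF indep, where Y = "\<lambda>_ y. exp (s * y)"]) auto
  have expsum: "exp (s * (\<Sum>i\<in>I. Y i \<omega>)) = (\<Prod>i\<in>I. exp (s * Y i \<omega>))" for \<omega>
    using I by (simp add: sum_distrib_left exp_sum)
  have intp: "integrable M (\<lambda>\<omega>. exp (s * (\<Sum>i\<in>I. Y i \<omega>)))"
    unfolding expsum by (rule indep_vars_integrable[OF I ind_exp int(3)])
  have "prob {\<omega>\<in>space M. t \<le> (\<Sum>i\<in>I. Y i \<omega>)}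
      \<le> exp (- s * t) * (\<integral>\<omega>\<in>space M. exp (s * (\<Sum>i\<in>I. Y i \<omega>)) \<partial>M)"
    using s integrable_mult_indicator[OF sets.top intp]
    by (intro Chernoff_ineq_ge) (auto simp: set_integrable_def)
  also have "(\<integral>\<omega>\<in>space M. exp (s * (\<Sum>i\<in>I. Y i \<omega>)) \<partial>M) = expectation (\<lambda>\<omega>. exp (s * (\<Sum>i\<in>I. Y i \<omega>)))"
    using intp by (intro set_integral_space)
  also have "\<dots> = (\<Prod>i\<in>I. expectation (\<lambda>\<omega>. exp (s * Y i \<omega>)))"
    unfolding expsum by (rule indep_vars_lebesgue_integral[OF I ind_exp int(3)])
  also have "\<dots> \<le> (\<Prod>i\<in>I. exp (s\<^sup>2 * v))"
    using mgf by (intro prod_mono) auto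
  also have "\<dots> = exp (card I * s\<^sup>2 * v)"
    by (simp add: exp_of_nat_mult[symmetric] mult.assoc)
  finally have "prob {\<omega>\<in>space M. t \<le> (\<Sum>i\<in>I. Y i \<omega>)} \<le> exp (- s * t) * exp (card I * s\<^sup>2 * v)"
    by simp
  then show ?thesis unfolding exp_add .
qed

lemma Bernstein_tail:
  fixes Y :: "'i \<Rightarrow> 'a \<Rightarrow> real" and b s t v :: real
  assumes I: "finite I" and indep: "indep_vars (\<lambda>_. borel) Y I"
    and mean: "\<And>i. i \<in> I \<Longrightarrow> expectation (Y i) = 0"
    and bound: "\<And>i \<omega>. i \<in> I \<Longrightarrow> \<omega> \<in> space M \<Longrightarrow> \<bar>Y i \<omega>\<bar> \<le> b"
    and var: "\<And>i. i \<in> I \<Longrightarrow> expectation (\<lambda>\<omega>. (Y i \<omega>)\<^sup>2) \<le> v"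
    and s: "0 < s" "s * b \<le> 1"
  shows "prob {\<omega>\<in>space M. t \<le> \<bar>\<Sum>i\<in>I. Y i \<omega>\<bar>} \<le> 2 * exp (- s * t + card I * s\<^sup>2 * v)"
proof -
  have Y: "random_variable borel (Y i)" if "i \<in> I" for i
    using indep that by (auto simp: indep_vars_def)
  then have S[measurable]: "random_variable borel (\<lambda>\<omega>. \<Sum>i\<in>I. Y i \<omega>)" by simp
  have "{\<omega>\<in>space M. t \<le> \<bar>\<Sum>i\<in>I. Y i \<omega>\<bar>}
      \<subseteq> {\<omega>\<in>space M. t \<le> (\<Sum>i\<in>I. Y i \<omega>)} \<union> {\<omega>\<in>space M. t \<le> (\<Sum>i\<in>I. - Y i \<omega>)}"
    by (auto simp: sum_negf abs_if split: if_splits)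
  then have "prob {\<omega>\<in>space M. t \<le> \<bar>\<Sum>i\<in>I. Y i \<omega>\<bar>}
      \<le> prob ({\<omega>\<in>space M. t \<le> (\<Sum>i\<in>I. Y i \<omega>)} \<union> {\<omega>\<in>space M. t \<le> (\<Sum>i\<in>I. - Y i \<omega>)})"
    using S by (intro finite_measure_mono) (auto simp: sum_negf)
  also have "\<dots> \<le> prob {\<omega>\<in>space M. t \<le> (\<Sum>i\<in>I. Y i \<omega>)} + prob {\<omega>\<in>space M. t \<le> (\<Sum>i\<in>I. - Y i \<omega>)}"
    using S by (intro measure_Un_le) (auto simp: sum_negf)
  also have "prob {\<omega>\<in>space M. t \<le> (\<Sum>i\<in>I. Y i \<omega>)} \<le> exp (- s * t + card I * s\<^sup>2 * v)"
    using assms by (rule Bernstein_upper_tail)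
  also have "prob {\<omega>\<in>space M. t \<le> (\<Sum>i\<in>I. - Y i \<omega>)} \<le> exp (- s * t + card I * s\<^sup>2 * v)"
  proof (rule Bernstein_upper_tail[OF I])
    show "indep_vars (\<lambda>_. borel) (\<lambda>i \<omega>. - Y i \<omega>) I"
      by (rule indep_vars_compose2[OF indep, where Y = "\<lambda>_ y. - y"]) auto
  qed (use assms in auto)
  finally show ?thesis by simp
qed

text \<open>The noise is independent of the design, so the union bound runs over the cuts that the
  design actually realises, and the expected number of these is polynomial in \<open>n\<close>.\<close>

lemma halfspace_sum_tail:
  fixes X :: "nat \<Rightarrow> 'a \<Rightarrow> 'b::euclidean_space" and e :: "nat \<Rightarrow> 'a \<Rightarrow> real" and g :: "nat \<Rightarrow> real \<Rightarrow> real"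
    and b s t v :: real
  assumes indep: "indep_vars (\<lambda>_. borel) (\<lambda>i \<omega>. (X i \<omega>, e i \<omega>)) {..<n}"
    and X: "\<And>i. i < n \<Longrightarrow> random_variable borel (X i)"
    and e: "\<And>i. i < n \<Longrightarrow> random_variable borel (e i)"
    and Xe: "\<And>i. i < n \<Longrightarrow>
      distr M borel (\<lambda>\<omega>. (X i \<omega>, e i \<omega>)) = distr M borel (X i) \<Otimes>\<^sub>M distr M borel (e i)"
    and g[measurable]: "\<And>i. g i \<in> borel_measurable borel"
    and mean: "\<And>i. i < n \<Longrightarrow> expectation (\<lambda>\<omega>. g i (e i \<omega>)) = 0"
    and bound: "\<And>i y. i < n \<Longrightarrow> \<bar>g i y\<bar> \<le> b"
    and var: "\<And>i. i < n \<Longrightarrow> expectation (\<lambda>\<omega>. (g i (e i \<omega>))\<^sup>2) \<le> v"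
    and s: "0 < s" "s * b \<le> 1"
  shows "{\<omega>\<in>space M. \<exists>S\<in>halfspace_cuts n (\<lambda>i. X i \<omega>). t \<le> \<bar>\<Sum>i\<in>S. g i (e i \<omega>)\<bar>} \<in> events"
    and "prob {\<omega>\<in>space M. \<exists>S\<in>halfspace_cuts n (\<lambda>i. X i \<omega>). t \<le> \<bar>\<Sum>i\<in>S. g i (e i \<omega>)\<bar>}
      \<le> real (n + 1) ^ (DIM('b) + 1) * (2 * exp (- s * t + real n * s\<^sup>2 * v))"
proof -
  \<comment> \<open>The variance bound is available only for indices below \<open>n\<close>, so it
    yields \<open>0 \<le> v\<close> only when there is such an index.\<close>
  have v: "0 \<le> v" if "0 < n"
    using var[OF that] by (rule order_trans[OF Bochner_Integration.integral_nonneg, rotated]) simp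
  define q where "q = 2 * exp (- s * t + n * s\<^sup>2 * v)"
  define G where "G S = {\<omega>\<in>space M. t \<le> \<bar>\<Sum>i\<in>S. g i (e i \<omega>)\<bar>}" for S
  define H where "H S = {\<omega>\<in>space M. S \<in> halfspace_cuts n (\<lambda>i. X i \<omega>)}" for S
  have HM: "H S \<in> events" for S
    unfolding H_def using X by measurable
  have GM: "G S \<in> events" if "S \<subseteq> {..<n}" for S
  proof -
    have [measurable]: "random_variable borel (\<lambda>\<omega>. \<Sum>i\<in>S. g i (e i \<omega>))"
      using that by (intro borel_measurable_sum measurable_compose[OF e g]) auto
    show ?thesis unfolding G_def by measurable
  qed
  let ?E = "{\<omega>\<in>space M. \<exists>S\<in>halfspace_cuts n (\<lambda>i. X i \<omega>). t \<le> \<bar>\<Sum>i\<in>S. g i (e i \<omega>)\<bar>}"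
  have E: "?E = (\<Union>S\<in>Pow {..<n}. H S \<inter> G S)"
    by (auto simp: H_def G_def halfspace_cuts_def)
  show "?E \<in> events"
    unfolding E using HM GM by (intro sets.finite_UN) auto
  \<comment> \<open>The components form two independent blocks, \<open>?A\<close> for the design and
    \<open>?B\<close> for the noise; \<open>H S\<close> and \<open>G S\<close> are preimages under
    one block each.\<close>
  have ind: "prob (H S \<inter> G S) = prob (H S) * prob (G S)" if S: "S \<subseteq> {..<n}" for S
  proof -
    let ?Z = "\<lambda>(i, b) \<omega>. if b then (X i \<omega>, 0) else (0, e i \<omega>)"
    let ?A = "{..<n} \<times> {True}" and ?B = "{..<n} \<times> {False}"
    have "indep_vars (\<lambda>_. borel) ?Z ({..<n} \<times> UNIV)"
      using Xe X e by (intro indep_vars_components indep) auto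
    then have "indep_var (PiM ?A (\<lambda>_. borel)) (\<lambda>\<omega>. restrict (\<lambda>j. ?Z j \<omega>) ?A)
                         (PiM ?B (\<lambda>_. borel)) (\<lambda>\<omega>. restrict (\<lambda>j. ?Z j \<omega>) ?B)"
      by (rule indep_var_restrict) auto
    moreover have "Measurable.pred (PiM ?A (\<lambda>_. borel))
        (\<lambda>z::nat \<times> bool \<Rightarrow> 'b \<times> real. S \<in> halfspace_cuts n (\<lambda>i. fst (z (i, True))))"
      by (intro pred_halfspace_cuts measurable_compose[OF measurable_component_singleton])
         (auto simp: borel_prod[symmetric])
    moreover have "Measurable.pred (PiM ?B (\<lambda>_. borel))
        (\<lambda>z::nat \<times> bool \<Rightarrow> 'b \<times> real. t \<le> \<bar>\<Sum>i\<in>S. g i (snd (z (i, False)))\<bar>)"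
    proof -
      have "(\<lambda>z::nat \<times> bool \<Rightarrow> 'b \<times> real. \<Sum>i\<in>S. g i (snd (z (i, False))))
          \<in> borel_measurable (PiM ?B (\<lambda>_. borel))"
        using S
        by (intro borel_measurable_sum measurable_compose[OF _ g]
              measurable_compose[OF measurable_component_singleton])
           (auto simp: borel_prod[symmetric])
      then show ?thesis by measurable
    qed
    ultimately have *: "indep_var
        (count_space UNIV) ((\<lambda>z. S \<in> halfspace_cuts n (\<lambda>i. fst (z (i, True)))) \<circ> (\<lambda>\<omega>. restrict (\<lambda>j. ?Z j \<omega>) ?A))
        (count_space UNIV) ((\<lambda>z. t \<le> \<bar>\<Sum>i\<in>S. g i (snd (z (i, False)))\<bar>) \<circ> (\<lambda>\<omega>. restrict (\<lambda>j. ?Z j \<omega>) ?B))"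
      by (rule indep_var_compose)
    \<comment> \<open>The restricted family agrees with \<open>X\<close> only at indices below
      \<open>n\<close>, and the cuts read no others.\<close>
    have cong: "halfspace_cuts n x = halfspace_cuts n y" if "\<And>i. i < n \<Longrightarrow> x i = y i" for x y :: "nat \<Rightarrow> 'b"
    proof -
      have "(\<forall>i\<in>T. c < \<gamma> \<bullet> x i) \<and> (\<forall>i\<in>{..<n} - T. \<gamma> \<bullet> x i < c) \<longleftrightarrow>
            (\<forall>i\<in>T. c < \<gamma> \<bullet> y i) \<and> (\<forall>i\<in>{..<n} - T. \<gamma> \<bullet> y i < c)" if "T \<subseteq> {..<n}" for T \<gamma> c
        using that \<open>\<And>i. i < n \<Longrightarrow> x i = y i\<close> by (metis DiffD1 lessThan_iff subsetD)
      then show ?thesis unfolding halfspace_cuts_def by (simp cong: conj_cong)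
    qed
    have c: "S \<in> halfspace_cuts n (\<lambda>i. fst (restrict (\<lambda>j. ?Z j \<omega>) ?A (i, True)))
        \<longleftrightarrow> S \<in> halfspace_cuts n (\<lambda>i. X i \<omega>)" for \<omega>
      by (subst cong[of _ "\<lambda>i. X i \<omega>"]) auto
    have d: "(\<Sum>i\<in>S. g i (snd (restrict (\<lambda>j. ?Z j \<omega>) ?B (i, False)))) = (\<Sum>i\<in>S. g i (e i \<omega>))" for \<omega>
      using S by (intro sum.cong) auto
    show ?thesis
      using prob_indep_random_variable[OF *, of "{True}" "{True}"]
      unfolding comp_def c d by (simp add: H_def G_def Int_def conj_ac)
  qed
  have Gq: "prob (G S) \<le> q" if S: "S \<subseteq> {..<n}" for S
  proof -
    have fS: "finite S" using S finite_subset by blast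
    have "indep_vars (\<lambda>_. borel) (\<lambda>i \<omega>. g i (snd (X i \<omega>, e i \<omega>))) {..<n}"
      by (rule indep_vars_compose2[OF indep, where Y = "\<lambda>i z. g i (snd z)"])
         (auto simp: borel_prod[symmetric])
    then have "indep_vars (\<lambda>_. borel) (\<lambda>i \<omega>. g i (e i \<omega>)) S"
      using S by (auto intro: indep_vars_subset)
    then have "prob (G S) \<le> 2 * exp (- s * t + card S * s\<^sup>2 * v)"
      unfolding G_def using S mean bound var s fS by (intro Bernstein_tail[where b=b]) auto
    also have "\<dots> \<le> q"
    proof (cases "n = 0")
      case False
      have "card S \<le> n" using card_mono[of "{..<n}" S] S by simp
      then have "card S * (s\<^sup>2 * v) \<le> n * (s\<^sup>2 * v)"
        using v False by (intro mult_right_mono) auto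
      then show ?thesis by (simp add: q_def mult.assoc)
    qed (use S in \<open>auto simp: q_def\<close>)
    finally show ?thesis .
  qed
  \<comment> \<open>Summing over all \<open>2 ^ n\<close> subsets is affordable: each is weighted by
    \<open>prob (H S)\<close>, and these weights add up to the expected number of realised
    cuts.\<close>
  have "prob ?E \<le> (\<Sum>S\<in>Pow {..<n}. prob (H S \<inter> G S))"
    unfolding E using HM GM by (intro finite_measure_subadditive_finite) auto
  also have "\<dots> \<le> (\<Sum>S\<in>Pow {..<n}. prob (H S) * q)"
    using ind Gq by (intro sum_mono) (auto intro!: mult_left_mono)
  also have "\<dots> = expectation (\<lambda>\<omega>. \<Sum>S\<in>Pow {..<n}. indicator (H S) \<omega>) * q"
    using HM by (subst Bochner_Integration.integral_sum)
      (auto simp: sum_distrib_right sets.Int_space_eq2 less_top[symmetric] intro!: integrable_real_indicator)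
  also have "expectation (\<lambda>\<omega>. \<Sum>S\<in>Pow {..<n}. indicator (H S) \<omega>) \<le> expectation (\<lambda>\<omega>. (n + 1) ^ (DIM('b) + 1))"
  proof (rule integral_mono)
    fix \<omega> assume \<omega>: "\<omega> \<in> space M"
    have "(\<Sum>S\<in>Pow {..<n}. indicator (H S) \<omega>) = (\<Sum>S\<in>Pow {..<n}. indicator (halfspace_cuts n (\<lambda>i. X i \<omega>)) S :: real)"
      using \<omega> by (intro sum.cong) (auto simp: H_def indicator_def)
    also have "\<dots> = (\<Sum>S\<in>Pow {..<n}. if S \<in> halfspace_cuts n (\<lambda>i. X i \<omega>) then 1 else 0)"
      by (intro sum.cong) (auto simp: indicator_def)
    also have "\<dots> = (\<Sum>S\<in>Pow {..<n} \<inter> halfspace_cuts n (\<lambda>i. X i \<omega>). 1)"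
      by (rule sum.inter_restrict[symmetric]) simp
    also have "Pow {..<n} \<inter> halfspace_cuts n (\<lambda>i. X i \<omega>) = halfspace_cuts n (\<lambda>i. X i \<omega>)"
      by (auto simp: halfspace_cuts_def)
    also have "(\<Sum>S\<in>\<dots>. 1) = real (card (halfspace_cuts n (\<lambda>i. X i \<omega>)))"
      by simp
    also have "\<dots> \<le> real ((n + 1) ^ (DIM('b) + 1))"
      using card_halfspace_cuts(2) by (rule of_nat_mono)
    finally show "(\<Sum>S\<in>Pow {..<n}. indicator (H S) \<omega>) \<le> real ((n + 1) ^ (DIM('b) + 1))" .
  qed (use HM in \<open>auto intro!: Bochner_Integration.integrable_sum integrable_real_indicator simp: less_top[symmetric]\<close>)
  finally have "prob ?E \<le> real (n + 1) ^ (DIM('b) + 1) * q"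
    by (simp add: prob_space q_def mult_right_mono distrib_right)
  then show "prob ?E \<le> real (n + 1) ^ (DIM('b) + 1) * (2 * exp (- s * t + real n * s\<^sup>2 * v))"
    unfolding q_def .
qed

end

section \<open>Truncation under a second moment\<close>

text \<open>The interval is half-open to match the strict event
  \<open>t < \<bar>Z \<omega>\<bar>\<close> in the layer-cake formula for the second moment.\<close>

lemma nn_integral_double_Ico:
  assumes "0 \<le> (a::real)"
  shows "(\<integral>\<^sup>+t. ennreal (2 * t) * indicator {0..<a} t \<partial>lborel) = ennreal (a\<^sup>2)"
proof -
  have "(\<integral>\<^sup>+t. ennreal (2 * t) * indicator {0..<a} t \<partial>lborel)
      = (\<integral>\<^sup>+t. ennreal (2 * t) * indicator {0..a} t \<partial>lborel)"
    using AE_lborel_singleton[of a]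
    by (intro nn_integral_cong_AE) (auto simp: indicator_def elim!: eventually_mono)
  also have "\<dots> = ennreal (a\<^sup>2 - 0\<^sup>2)"
    using assms by (intro nn_integral_FTC_Icc) (auto intro!: derivative_eq_intros)
  finally show ?thesis by simp
qed

text \<open>Nonnegative weights have nondecreasing partial sums, so the retained terms form an
  initial segment, whose total is the last partial sum below \<open>u\<close>.\<close>

lemma sum_below_partial_sum_le:
  fixes c :: "nat \<Rightarrow> real"
  assumes "\<And>i. 0 \<le> c i" "0 \<le> u"
  shows "(\<Sum>i<N. if (\<Sum>j\<le>i. c j) < u then c i else 0) \<le> u"
proof (induction N)
  case (Suc N)
  show ?case
  proof (cases "(\<Sum>j\<le>N. c j) < u")
    case True
    have "(\<Sum>i<Suc N. if (\<Sum>j\<le>i. c j) < u then c i else 0) \<le> (\<Sum>i<Suc N. c i)"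
      using assms(1) by (intro sum_mono) auto
    also have "\<dots> = (\<Sum>j\<le>N. c j)" by (simp add: lessThan_Suc_atMost)
    finally show ?thesis using True by simp
  qed (use Suc in simp)
qed (use assms in simp)

context prob_space
begin

text \<open>By the layer-cake formula the second moment is the integral of
  \<open>2 * t * G t\<close> over \<open>t \<ge> 0\<close>. Since \<open>h = G powr (1 / p)\<close>
  is nonincreasing with finite integral \<open>c\<close>, \<open>t * h t \<le> c\<close>; since
  \<open>p \<ge> 2\<close> and \<open>G t \<le> 1\<close>, \<open>G t \<le> h t * h t\<close>. Hence
  \<open>t * G t \<le> c * h t\<close>, which is integrable.\<close>

lemma integrable_square_if_tail:
  fixes Z :: "'a \<Rightarrow> real"
  assumes Z[measurable]: "Z \<in> borel_measurable M" and p: "2 \<le> p"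
    and tail: "(\<integral>\<^sup>+ t. indicator {0..} t *
                 ennreal (prob {\<omega>\<in>space M. \<bar>Z \<omega>\<bar> > t} powr (1 / p)) \<partial>lborel) < \<infinity>"
  shows "integrable M (\<lambda>\<omega>. (Z \<omega>)\<^sup>2)"
proof -
  define G where "G t = prob {\<omega>\<in>space M. \<bar>Z \<omega>\<bar> > t}" for t
  define h where "h t = G t powr (1 / p)" for t
  define I where "I = (\<integral>\<^sup>+ t. indicator {0..} t * ennreal (h t) \<partial>lborel)"
  have "I < \<infinity>" using tail by (simp add: I_def h_def G_def)
  then obtain c where c: "0 \<le> c" "I = ennreal c" by (cases I) auto
  have G01: "0 \<le> G t" "G t \<le> 1" for t by (auto simp: G_def)
  have Gmono: "G t \<le> G s" if "s \<le> t" for s t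
    unfolding G_def using that by (intro finite_measure_mono) auto
  have hmono: "h t \<le> h s" if "s \<le> t" for s t
    unfolding h_def using Gmono[OF that] G01 p by (intro powr_mono2) auto
  have "antimono G" using Gmono by (auto simp: antimono_def)
  then have "mono (\<lambda>t. - G t)" by (auto simp: antimono_def mono_def)
  then have "(\<lambda>t. - (- G t)) \<in> borel_measurable borel"
    by (intro borel_measurable_uminus borel_measurable_mono)
  then have Gm[measurable]: "G \<in> borel_measurable borel" by simp
  have hm[measurable]: "h \<in> borel_measurable borel" unfolding h_def by measurable
  have th: "t * h t \<le> c" if t: "0 \<le> t" for t
  proof -
    have "ennreal (t * h t) = (\<integral>\<^sup>+ s. ennreal (h t) * indicator {0..t} s \<partial>lborel)"
      using t by (subst nn_integral_cmult_indicator) (auto simp: ennreal_mult' mult.commute)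
    also have "\<dots> \<le> I"
      unfolding I_def using hmono
      by (intro nn_integral_mono) (auto simp: indicator_def intro!: ennreal_leI)
    finally show ?thesis using c by simp
  qed
  have tG: "t * G t \<le> c * h t" if t: "0 \<le> t" for t
  proof -
    have "G t = G t powr 1" using G01 by simp
    also have "\<dots> \<le> G t powr (1 / p + 1 / p)"
      using G01[of t] p by (intro powr_mono') (auto simp: field_simps)
    also have "\<dots> = h t * h t" unfolding h_def by (rule powr_add)
    finally have "t * G t \<le> (t * h t) * h t"
      using t by (simp add: mult.assoc mult_left_mono)
    also have "\<dots> \<le> c * h t" using th[OF t] by (intro mult_right_mono) (auto simp: h_def)
    finally show ?thesis .
  qed
  interpret P: pair_sigma_finite M lborel ..
  let ?f = "\<lambda>(\<omega>, t). ennreal (2 * t) * indicator {0..<\<bar>Z \<omega>\<bar>} t"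
  have f: "?f = (\<lambda>x. if 0 \<le> snd x \<and> snd x < \<bar>Z (fst x)\<bar> then ennreal (2 * snd x) else 0)"
    by (auto simp: fun_eq_iff indicator_def)
  have fm: "?f \<in> borel_measurable (M \<Otimes>\<^sub>M lborel)"
    unfolding f by measurable
  have "(\<integral>\<^sup>+\<omega>. ennreal ((Z \<omega>)\<^sup>2) \<partial>M) = (\<integral>\<^sup>+\<omega>. \<integral>\<^sup>+t. ?f (\<omega>, t) \<partial>lborel \<partial>M)"
    using nn_integral_double_Ico[of "\<bar>Z _\<bar>"] by (intro nn_integral_cong) simp
  also have "\<dots> = (\<integral>\<^sup>+t. \<integral>\<^sup>+\<omega>. ?f (\<omega>, t) \<partial>M \<partial>lborel)"
    by (rule P.Fubini[OF fm, symmetric])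
  also have "\<dots> \<le> (\<integral>\<^sup>+t. ennreal (2 * c) * (indicator {0..} t * ennreal (h t)) \<partial>lborel)"
  proof (rule nn_integral_mono)
    fix t :: real
    show "(\<integral>\<^sup>+\<omega>. ?f (\<omega>, t) \<partial>M) \<le> ennreal (2 * c) * (indicator {0..} t * ennreal (h t))"
    proof (cases "0 \<le> t")
      case True
      have "(\<integral>\<^sup>+\<omega>. ?f (\<omega>, t) \<partial>M) = (\<integral>\<^sup>+\<omega>. ennreal (2 * t) * indicator {\<omega>\<in>space M. \<bar>Z \<omega>\<bar> > t} \<omega> \<partial>M)"
        using True by (intro nn_integral_cong) (auto simp: indicator_def)
      also have "\<dots> = ennreal (2 * t) * emeasure M {\<omega>\<in>space M. \<bar>Z \<omega>\<bar> > t}"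
        by (subst nn_integral_cmult_indicator) auto
      also have "\<dots> = ennreal (2 * (t * G t))"
        using True by (simp add: G_def emeasure_eq_measure ennreal_mult' mult.assoc)
      also have "\<dots> \<le> ennreal (2 * (c * h t))"
        using tG[OF True] by (intro ennreal_leI) simp
      also have "\<dots> = ennreal (2 * c) * (indicator {0..} t * ennreal (h t))"
        using True c by (simp add: ennreal_mult' mult.assoc)
      finally show ?thesis .
    next
      case False
      then have "(\<integral>\<^sup>+\<omega>. ?f (\<omega>, t) \<partial>M) = (\<integral>\<^sup>+\<omega>. 0 \<partial>M)"
        by (intro nn_integral_cong) (auto simp: indicator_def)
      then show ?thesis by simp
    qed
  qed
  also have "\<dots> = ennreal (2 * c) * I"
    unfolding I_def by (rule nn_integral_cmult) simp
  also have "\<dots> < \<infinity>" using c by (simp add: ennreal_mult_less_top)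
  finally show ?thesis
    by (intro integrableI_nonneg) auto
qed

text \<open>Truncating the \<open>i\<close>-th variable at the partial sum of the weights makes the
  weighted remainder telescope against the second moment.\<close>

lemma truncation_remainder:
  fixes e :: "nat \<Rightarrow> 'a \<Rightarrow> real" and c :: "nat \<Rightarrow> real"
  assumes e[measurable]: "\<And>i. random_variable borel (e i)"
    and same: "\<And>i. distr M borel (e i) = distr M borel (e 0)"
    and sq: "integrable M (\<lambda>\<omega>. (e 0 \<omega>)\<^sup>2)"
    and c: "\<And>i. 0 \<le> c i"
  defines "z \<equiv> \<lambda>i y::real. if (\<Sum>j\<le>i. c j) < \<bar>y\<bar> then y else 0"
  shows "AE \<omega> in M. \<exists>C. \<forall>n. (\<Sum>i<n. c i * \<bar>z i (e i \<omega>)\<bar>) \<le> C"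
    and "(\<Sum>i<n. c i * expectation (\<lambda>\<omega>. \<bar>z i (e i \<omega>)\<bar>)) \<le> expectation (\<lambda>\<omega>. (e 0 \<omega>)\<^sup>2)"
proof -
  define v where "v = expectation (\<lambda>\<omega>. (e 0 \<omega>)\<^sup>2)"
  have zm[measurable]: "z i \<in> borel_measurable borel" for i
    unfolding z_def by measurable
  have zle: "(\<Sum>i<n. c i * \<bar>z i y\<bar>) \<le> y\<^sup>2" for n y
  proof -
    have "(\<Sum>i<n. c i * \<bar>z i y\<bar>) = \<bar>y\<bar> * (\<Sum>i<n. if (\<Sum>j\<le>i. c j) < \<bar>y\<bar> then c i else 0)"
      by (subst sum_distrib_left) (auto simp: z_def intro!: sum.cong)
    also have "\<dots> \<le> \<bar>y\<bar> * \<bar>y\<bar>"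
      using c by (intro mult_left_mono sum_below_partial_sum_le) auto
    finally show ?thesis by (simp add: power2_eq_square)
  qed
  \<comment> \<open>Each term involves one variable only, so inside the expectation every
    \<open>e i\<close> may be replaced by \<open>e 0\<close>. All terms then share one argument, and
    \<open>zle\<close> applies pointwise.\<close>
  have nnsame: "(\<integral>\<^sup>+\<omega>. ennreal \<bar>z i (e i \<omega>)\<bar> \<partial>M) = (\<integral>\<^sup>+\<omega>. ennreal \<bar>z i (e 0 \<omega>)\<bar> \<partial>M)" for i
  proof -
    have "(\<integral>\<^sup>+\<omega>. ennreal \<bar>z i (e j \<omega>)\<bar> \<partial>M) = (\<integral>\<^sup>+y. ennreal \<bar>z i y\<bar> \<partial>distr M borel (e j))" for j
      by (subst nn_integral_distr) auto
    then show ?thesis by (simp only: same[of i])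
  qed
  have nn: "(\<integral>\<^sup>+\<omega>. ennreal (\<Sum>i<n. c i * \<bar>z i (e i \<omega>)\<bar>) \<partial>M) \<le> ennreal v" for n
  proof -
    have "(\<integral>\<^sup>+\<omega>. ennreal (\<Sum>i<n. c i * \<bar>z i (e i \<omega>)\<bar>) \<partial>M)
        = (\<integral>\<^sup>+\<omega>. (\<Sum>i<n. ennreal (c i) * ennreal \<bar>z i (e i \<omega>)\<bar>) \<partial>M)"
      using c by (simp add: sum_ennreal[symmetric] ennreal_mult)
    also have "\<dots> = (\<Sum>i<n. ennreal (c i) * (\<integral>\<^sup>+\<omega>. ennreal \<bar>z i (e 0 \<omega>)\<bar> \<partial>M))"
      by (subst nn_integral_sum) (auto simp: nn_integral_cmult nnsame)
    also have "\<dots> = (\<integral>\<^sup>+\<omega>. (\<Sum>i<n. ennreal (c i) * ennreal \<bar>z i (e 0 \<omega>)\<bar>) \<partial>M)"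
      by (subst nn_integral_sum) (auto simp: nn_integral_cmult)
    also have "\<dots> = (\<integral>\<^sup>+\<omega>. ennreal (\<Sum>i<n. c i * \<bar>z i (e 0 \<omega>)\<bar>) \<partial>M)"
      using c by (simp add: sum_ennreal[symmetric] ennreal_mult)
    also have "\<dots> \<le> (\<integral>\<^sup>+\<omega>. ennreal ((e 0 \<omega>)\<^sup>2) \<partial>M)"
      using zle by (intro nn_integral_mono ennreal_leI)
    also have "\<dots> = ennreal v"
      unfolding v_def by (rule nn_integral_eq_integral[OF sq]) simp
    finally show ?thesis .
  qed
  \<comment> \<open>Monotone convergence passes the bound to the whole series, which is therefore
    finite almost surely; its value bounds all partial sums at once.\<close>
  have "(\<integral>\<^sup>+\<omega>. (SUP n. ennreal (\<Sum>i<n. c i * \<bar>z i (e i \<omega>)\<bar>)) \<partial>M)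
      = (SUP n. \<integral>\<^sup>+\<omega>. ennreal (\<Sum>i<n. c i * \<bar>z i (e i \<omega>)\<bar>) \<partial>M)"
    using c by (intro nn_integral_monotone_convergence_SUP)
      (auto simp: incseq_def le_fun_def intro!: ennreal_leI sum_mono2)
  also have "\<dots> \<le> ennreal v" using nn by (intro SUP_least)
  finally have "(\<integral>\<^sup>+\<omega>. (SUP n. ennreal (\<Sum>i<n. c i * \<bar>z i (e i \<omega>)\<bar>)) \<partial>M) < \<infinity>"
    by (rule order.strict_trans1) simp
  then have "AE \<omega> in M. (SUP n. ennreal (\<Sum>i<n. c i * \<bar>z i (e i \<omega>)\<bar>)) \<noteq> \<infinity>"
    by (intro nn_integral_noteq_infinite) (auto simp: less_top)
  then show "AE \<omega> in M. \<exists>C. \<forall>n. (\<Sum>i<n. c i * \<bar>z i (e i \<omega>)\<bar>) \<le> C"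
  proof (rule AE_mp, intro AE_I2 impI)
    fix \<omega> assume "(SUP n. ennreal (\<Sum>i<n. c i * \<bar>z i (e i \<omega>)\<bar>)) \<noteq> \<infinity>"
    then obtain C where C: "0 \<le> C" "(SUP n. ennreal (\<Sum>i<n. c i * \<bar>z i (e i \<omega>)\<bar>)) = ennreal C"
      by (cases "SUP n. ennreal (\<Sum>i<n. c i * \<bar>z i (e i \<omega>)\<bar>)") auto
    have "(\<Sum>i<n. c i * \<bar>z i (e i \<omega>)\<bar>) \<le> C" for n
    proof -
      have "ennreal (\<Sum>i<n. c i * \<bar>z i (e i \<omega>)\<bar>) \<le> ennreal C"
        unfolding C(2)[symmetric] by (rule SUP_upper) simp
      then show ?thesis using C(1) by simp
    qed
    then show "\<exists>C. \<forall>n. (\<Sum>i<n. c i * \<bar>z i (e i \<omega>)\<bar>) \<le> C" by blast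
  qed
  have zint: "integrable M (\<lambda>\<omega>. c i * \<bar>z i (e i \<omega>)\<bar>)" for i
  proof (rule integrableI_nonneg)
    have "(\<integral>\<^sup>+\<omega>. ennreal (c i * \<bar>z i (e i \<omega>)\<bar>) \<partial>M) \<le> (\<integral>\<^sup>+\<omega>. ennreal (\<Sum>i<Suc i. c i * \<bar>z i (e i \<omega>)\<bar>) \<partial>M)"
      using c by (intro nn_integral_mono ennreal_leI) (auto intro!: sum_nonneg)
    also have "\<dots> \<le> ennreal v" by (rule nn)
    finally show "(\<integral>\<^sup>+\<omega>. ennreal (c i * \<bar>z i (e i \<omega>)\<bar>) \<partial>M) < \<infinity>"
      by (rule order.strict_trans1) simp
  qed (use c in auto)
  have "(\<Sum>i<n. c i * expectation (\<lambda>\<omega>. \<bar>z i (e i \<omega>)\<bar>)) = expectation (\<lambda>\<omega>. \<Sum>i<n. c i * \<bar>z i (e i \<omega>)\<bar>)"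
    using zint by simp
  also have "ennreal \<dots> = (\<integral>\<^sup>+\<omega>. ennreal (\<Sum>i<n. c i * \<bar>z i (e i \<omega>)\<bar>) \<partial>M)"
    using zint c by (intro nn_integral_eq_integral[symmetric]) (auto intro!: sum_nonneg)
  also have "\<dots> \<le> ennreal v" by (rule nn)
  finally show "(\<Sum>i<n. c i * expectation (\<lambda>\<omega>. \<bar>z i (e i \<omega>)\<bar>)) \<le> expectation (\<lambda>\<omega>. (e 0 \<omega>)\<^sup>2)"
    unfolding v_def by (subst (asm) ennreal_le_iff) auto
qed

end

section \<open>The scale \<open>sqrt (n * ln n)\<close> and the almost sure bound over
  half-spaces\<close>

lemma ln8_ge_2: "2 \<le> ln (8::real)"
proof -
  have "exp (2::real) = (exp 1)\<^sup>2" by (simp add: exp_of_nat_mult[symmetric])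
  also have "\<dots> \<le> (272/100)\<^sup>2"
    using e_less_272 by (intro power_mono) auto
  also have "\<dots> \<le> 8" by (simp add: power2_eq_square)
  finally have "ln (exp 2) \<le> ln (8::real)" by (subst ln_le_cancel_iff) auto
  then show ?thesis by simp
qed

text \<open>The offset 8 gives \<open>ln (n + 8) \<ge> 2\<close>, which makes the increments of
  \<open>sqrt ((n + 1) / ln (n + 8))\<close> comparable to \<open>1 / sqrt_log_scale n\<close> already from \<open>n = 0\<close> on.\<close>

definition sqrt_log_scale :: "nat \<Rightarrow> real" where
  "sqrt_log_scale n = sqrt ((real n + 1) * ln (real n + 8))"

lemma ln_add_8_ge_2: "2 \<le> ln (real n + 8)"
proof -
  have "ln 8 \<le> ln (real n + 8)" by (subst ln_le_cancel_iff) auto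
  with ln8_ge_2 show ?thesis by linarith
qed

lemma sqrt_log_scale_pos: "0 < sqrt_log_scale n"
  using ln_add_8_ge_2[of n] by (simp add: sqrt_log_scale_def)

lemma sqrt_log_scale_mono: "m \<le> n \<Longrightarrow> sqrt_log_scale m \<le> sqrt_log_scale n"
  unfolding sqrt_log_scale_def using ln_add_8_ge_2[of m]
  by (intro real_sqrt_le_mono mult_mono) auto

text \<open>The induction compares increments. With \<open>f\<close>, \<open>g\<close> the square
  roots at \<open>n\<close>, \<open>Suc n\<close> and \<open>L\<close>, \<open>K\<close> the
  logarithms, \<open>(n + 1) * (K - L) \<le> 1 \<le> L / 2\<close> gives
  \<open>1 / (2 * K) \<le> g^2 - f^2 \<le> 2 * g * (g - f)\<close>. The new summand is
  \<open>1 / (K * g)\<close>, hence at most \<open>4 * (g - f)\<close>.\<close>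

lemma sum_inverse_sqrt_log_scale_le:
  "(\<Sum>j\<le>n. 1 / sqrt_log_scale j) \<le> 4 * sqrt ((real n + 1) / ln (real n + 8))"
proof (induction n)
  case 0
  show ?case using ln8_ge_2 by (simp add: sqrt_log_scale_def real_sqrt_divide field_simps)
next
  case (Suc n)
  define L where "L = ln (real n + 8)"
  define K where "K = ln (real (Suc n) + 8)"
  define f where "f = sqrt ((real n + 1) / L)"
  define g where "g = sqrt ((real (Suc n) + 1) / K)"
  have L: "2 \<le> L" and K: "2 \<le> K"
    using ln_add_8_ge_2[of n] ln_add_8_ge_2[of "Suc n"] by (auto simp: L_def K_def)
  have "K - L = ln ((real (Suc n) + 8) / (real n + 8))"
    unfolding K_def L_def by (subst ln_div) auto
  also have "(real (Suc n) + 8) / (real n + 8) = 1 + 1 / (real n + 8)"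
    by (simp add: field_simps)
  also have "ln \<dots> \<le> 1 / (real n + 8)" by (intro ln_add_one_self_le_self) auto
  finally have "(real n + 1) * (K - L) \<le> (real n + 1) * (1 / (real n + 8))"
    by (intro mult_left_mono) auto
  also have "\<dots> \<le> 1" by simp
  finally have KL: "(real n + 1) * (K - L) \<le> 1" .
  have "(L / 2) / (L * K) \<le> (L - (real n + 1) * (K - L)) / (L * K)"
    using KL L K by (intro divide_right_mono) auto
  also have "\<dots> = (real n + 2) / K - (real n + 1) / L"
    using L K by (simp add: field_simps)
  also have "\<dots> = g\<^sup>2 - f\<^sup>2"
    using L K by (simp add: f_def g_def)
  finally have diff: "1 / (2 * K) \<le> g\<^sup>2 - f\<^sup>2"
    using L K by simp
  have g: "0 < g" "0 \<le> f" using L K by (auto simp: f_def g_def)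
  have "0 < 1 / (2 * K)" using K by simp
  with diff have "f\<^sup>2 \<le> g\<^sup>2" by linarith
  then have fg: "f \<le> g" by (rule power2_le_imp_le) (use g in simp)
  have "sqrt_log_scale (Suc n) = sqrt (K\<^sup>2 * ((real (Suc n) + 1) / K))"
    unfolding sqrt_log_scale_def K_def[symmetric] using K by (simp add: power2_eq_square mult.commute)
  also have "\<dots> = K * g"
    unfolding real_sqrt_mult g_def using K by simp
  finally have a: "sqrt_log_scale (Suc n) = K * g" .
  have "1 / (2 * K) \<le> (g - f) * (g + f)"
    using diff by (simp add: power2_eq_square algebra_simps)
  also have "\<dots> \<le> (g - f) * (2 * g)"
    using fg by (intro mult_left_mono) auto
  finally have "1 / sqrt_log_scale (Suc n) \<le> 4 * (g - f)"
    unfolding a using K g by (simp add: field_simps)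
  then show ?case
    using Suc unfolding f_def g_def L_def K_def by simp
qed

lemma (in prob_space) variance_le_second_moment:
  assumes "integrable M (Z :: 'a \<Rightarrow> real)" "integrable M (\<lambda>\<omega>. (Z \<omega>)\<^sup>2)"
  shows "expectation (\<lambda>\<omega>. (Z \<omega> - expectation Z)\<^sup>2) \<le> expectation (\<lambda>\<omega>. (Z \<omega>)\<^sup>2)"
  using variance_eq[OF assms] by simp

text \<open>The noise \<open>e i\<close> is truncated at \<open>\<Sum>j\<le>i. 1 / sqrt_log_scale j\<close>, of order \<open>sqrt (i / ln i)\<close>: just low
  enough for Bernstein's inequality at deviation \<open>sqrt_log_scale n\<close>, and just high enough for the
  remainder to be controlled by the second moment alone.\<close>

lemma (in prob_space) halfspace_sums_AE_bound:
  fixes X :: "nat \<Rightarrow> 'a \<Rightarrow> 'b::euclidean_space" and e :: "nat \<Rightarrow> 'a \<Rightarrow> real"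
  assumes indep: "indep_vars (\<lambda>_. borel) (\<lambda>i \<omega>. (X i \<omega>, e i \<omega>)) UNIV"
    and X: "\<And>i. random_variable borel (X i)"
    and e[measurable]: "\<And>i. random_variable borel (e i)"
    and Xe: "\<And>i. distr M borel (\<lambda>\<omega>. (X i \<omega>, e i \<omega>)) = distr M borel (X i) \<Otimes>\<^sub>M distr M borel (e i)"
    and same: "\<And>i. distr M borel (e i) = distr M borel (e 0)"
    and int: "integrable M (e 0)" and mean: "expectation (e 0) = 0"
    and sq: "integrable M (\<lambda>\<omega>. (e 0 \<omega>)\<^sup>2)"
  shows "AE \<omega> in M. \<exists>C. \<forall>\<^sub>F n in sequentially. \<forall>\<gamma> c.
           \<bar>\<Sum>i | i < n \<and> c < \<gamma> \<bullet> X i \<omega>. e i \<omega>\<bar> \<le> C * sqrt_log_scale n"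
proof -
  define c where "c i = 1 / sqrt_log_scale i" for i
  define B where "B i = (\<Sum>j\<le>i. c j)" for i
  define z where "z = (\<lambda>i y::real. if B i < \<bar>y\<bar> then y else 0)"
  define u where "u = (\<lambda>i y::real. if B i < \<bar>y\<bar> then 0 else y)"
  define m where "m i = expectation (\<lambda>\<omega>. u i (e i \<omega>))" for i
  define g where "g i y = u i y - m i" for i y
  define v where "v = expectation (\<lambda>\<omega>. (e 0 \<omega>)\<^sup>2)"
  have v: "0 \<le> v" unfolding v_def by simp
  have c: "0 < c i" for i using sqrt_log_scale_pos by (simp add: c_def)
  have B: "0 \<le> B i" "B i \<le> B n" if "i \<le> n" for i n
    unfolding B_def using that c by (auto intro!: sum_nonneg sum_mono2 simp: less_imp_le)
  have zm[measurable]: "z i \<in> borel_measurable borel" and um[measurable]: "u i \<in> borel_measurable borel" for i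
    unfolding z_def u_def by measurable
  have gm: "g i \<in> borel_measurable borel" for i
    unfolding g_def by measurable
  have transfer: "expectation (\<lambda>\<omega>. f (e i \<omega>)) = expectation (\<lambda>\<omega>. f (e 0 \<omega>))"
      "integrable M (\<lambda>\<omega>. f (e i \<omega>)) \<longleftrightarrow> integrable M (\<lambda>\<omega>. f (e 0 \<omega>))"
    if [measurable]: "f \<in> borel_measurable borel" for f :: "real \<Rightarrow> real" and i
  proof -
    have "expectation (\<lambda>\<omega>. f (e j \<omega>)) = (\<integral>y. f y \<partial>distr M borel (e j))" for j
      by (subst integral_distr) auto
    then show "expectation (\<lambda>\<omega>. f (e i \<omega>)) = expectation (\<lambda>\<omega>. f (e 0 \<omega>))"
      by (simp only: same[of i])
    have "integrable M (\<lambda>\<omega>. f (e j \<omega>)) \<longleftrightarrow> integrable (distr M borel (e j)) f" for j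
      by (subst integrable_distr_eq) auto
    then show "integrable M (\<lambda>\<omega>. f (e i \<omega>)) \<longleftrightarrow> integrable M (\<lambda>\<omega>. f (e 0 \<omega>))"
      by (simp only: same[of i])
  qed
  have inte: "integrable M (e i)" and meane: "expectation (e i) = 0"
    and sqe: "integrable M (\<lambda>\<omega>. (e i \<omega>)\<^sup>2)" and ve: "expectation (\<lambda>\<omega>. (e i \<omega>)\<^sup>2) = v" for i
    using transfer[of "\<lambda>y. y" i] transfer[of "\<lambda>y. y\<^sup>2" i] int mean sq by (auto simp: v_def)
  have intu: "integrable M (\<lambda>\<omega>. u i (e i \<omega>))" for i
    by (rule Bochner_Integration.integrable_bound[OF inte[of i]]) (auto simp: u_def)
  have intu2: "integrable M (\<lambda>\<omega>. (u i (e i \<omega>))\<^sup>2)" for i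
    by (rule Bochner_Integration.integrable_bound[OF sqe[of i]]) (auto simp: u_def)
  have intz: "integrable M (\<lambda>\<omega>. z i (e i \<omega>))" for i
    by (rule Bochner_Integration.integrable_bound[OF inte[of i]]) (auto simp: z_def)
  have split: "u i y + z i y = y" for i y by (simp add: u_def z_def)
  \<comment> \<open>The noise is centred, so the mean of the truncated part is minus that of the
    remainder: the recentring \<open>m i\<close> is controlled by the remainder too.\<close>
  have "m i + expectation (\<lambda>\<omega>. z i (e i \<omega>)) = 0" for i
    unfolding m_def using intu[of i] intz[of i] meane[of i]
    by (simp add: split flip: Bochner_Integration.integral_add)
  then have m_le: "\<bar>m i\<bar> \<le> expectation (\<lambda>\<omega>. \<bar>z i (e i \<omega>)\<bar>)" for i
    using integral_abs_bound[of M "\<lambda>\<omega>. z i (e i \<omega>)"] by (simp add: add_eq_0_iff2)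
  have u_le: "\<bar>u i y\<bar> \<le> B i" for i y
    using B(1)[of i i] by (auto simp: u_def)
  have mB: "\<bar>m i\<bar> \<le> B i" for i
  proof -
    have "\<bar>m i\<bar> \<le> expectation (\<lambda>\<omega>. \<bar>u i (e i \<omega>)\<bar>)"
      unfolding m_def by (rule integral_abs_bound)
    also have "\<dots> \<le> expectation (\<lambda>\<omega>. B i)"
      using intu[of i] u_le by (intro integral_mono) auto
    finally show ?thesis by (simp add: prob_space)
  qed
  have gB: "\<bar>g i y\<bar> \<le> 2 * B n" if "i \<le> n" for i n y
    using u_le[of i y] mB[of i] B(2)[OF that] by (simp add: g_def)
  have gmean: "expectation (\<lambda>\<omega>. g i (e i \<omega>)) = 0" for i
    using intu[of i] by (simp add: g_def m_def prob_space)
  have gvar: "expectation (\<lambda>\<omega>. (g i (e i \<omega>))\<^sup>2) \<le> v" for i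
  proof -
    have "expectation (\<lambda>\<omega>. (g i (e i \<omega>))\<^sup>2) \<le> expectation (\<lambda>\<omega>. (u i (e i \<omega>))\<^sup>2)"
      unfolding g_def m_def by (rule variance_le_second_moment[OF intu intu2])
    also have "\<dots> \<le> expectation (\<lambda>\<omega>. (e i \<omega>)\<^sup>2)"
      using intu2[of i] sqe[of i] by (intro integral_mono) (auto simp: u_def)
    finally show ?thesis by (simp add: ve)
  qed
  \<comment> \<open>\<open>K\<close> solves \<open>K / 8 - v / 64 = d + 2\<close>. As
    \<open>s * sqrt_log_scale n\<close> will equal \<open>L / 8\<close>, the exponent is then at
    most \<open>- (d + 2) * L\<close>, and the factor \<open>1 / (n + 8) ^ (d + 2)\<close> absorbs
    the \<open>(n + 1) ^ d\<close> cuts and leaves a summable inverse square.\<close>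
  define d where "d = DIM('b) + 1"
  define K where "K = 8 * (v / 64 + (d + 2))"
  define Bad where "Bad n = {\<omega>\<in>space M. \<exists>S\<in>halfspace_cuts n (\<lambda>i. X i \<omega>).
      K * sqrt_log_scale n \<le> \<bar>\<Sum>i\<in>S. g i (e i \<omega>)\<bar>}" for n
  have Bad: "Bad n \<in> events" "prob (Bad n) \<le> 2 * inverse (real (Suc n) ^ 2)" for n
  proof -
    define L where "L = ln (real n + 8)"
    \<comment> \<open>The centred truncated noise is bounded by
      \<open>2 * B n \<le> 8 * sqrt ((n + 1) / L)\<close>; \<open>s\<close> is the reciprocal of the
      right-hand side.\<close>
    define s where "s = sqrt (L / (real n + 1)) / 8"
    have L: "2 \<le> L" unfolding L_def by (rule ln_add_8_ge_2)
    have s: "0 < s" using L by (simp add: s_def)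
    have "s * (2 * B n) \<le> s * (2 * (4 * sqrt ((real n + 1) / L)))"
      using s sum_inverse_sqrt_log_scale_le[of n] by (simp add: B_def c_def L_def)
    also have "\<dots> = sqrt (L / (real n + 1) * ((real n + 1) / L))"
      unfolding s_def real_sqrt_mult by simp
    also have "\<dots> = 1" using L by simp
    finally have sB: "s * (2 * B n) \<le> 1" .
    have "indep_vars (\<lambda>_. borel) (\<lambda>i \<omega>. (X i \<omega>, e i \<omega>)) {..<n}"
      using indep by (rule indep_vars_subset) simp
    note tail = halfspace_sum_tail[OF this X e Xe gm gmean gB gvar s sB, of "K * sqrt_log_scale n"]
    show "Bad n \<in> events"
      unfolding Bad_def by (rule tail(1)) auto
    have sq_s: "real n * s\<^sup>2 * v \<le> L * v / 64"
    proof -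
      have "real n * s\<^sup>2 * v = (real n / (real n + 1)) * (L * v / 64)"
        using L by (simp add: s_def power_divide)
      also have "\<dots> \<le> 1 * (L * v / 64)"
        using L v by (intro mult_right_mono) auto
      finally show ?thesis by simp
    qed
    have "s * sqrt_log_scale n = sqrt (L / (real n + 1) * ((real n + 1) * L)) / 8"
      unfolding s_def sqrt_log_scale_def L_def[symmetric] real_sqrt_mult by simp
    also have "L / (real n + 1) * ((real n + 1) * L) = L\<^sup>2"
      by (simp add: power2_eq_square)
    also have "sqrt (L\<^sup>2) = L" using L by simp
    finally have sl: "s * sqrt_log_scale n = L / 8" .
    have "- s * (K * sqrt_log_scale n) + real n * s\<^sup>2 * v = - K * (s * sqrt_log_scale n) + real n * s\<^sup>2 * v"
      by simp
    also have "\<dots> \<le> - K * (L / 8) + L * v / 64" unfolding sl using sq_s by simp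
    also have "\<dots> = - (real (d + 2) * L)" by (simp add: K_def field_simps)
    finally have "exp (- s * (K * sqrt_log_scale n) + real n * s\<^sup>2 * v) \<le> exp (- (real (d + 2) * L))"
      by (simp only: exp_le_cancel_iff)
    also have "\<dots> = inverse ((real n + 8) ^ (d + 2))"
      unfolding exp_minus exp_of_nat_mult L_def by simp
    finally have ex: "exp (- s * (K * sqrt_log_scale n) + real n * s\<^sup>2 * v) \<le> inverse ((real n + 8) ^ (d + 2))" .
    have qeq: "q ^ d * (2 * inverse (q ^ (d + 2))) = 2 * inverse (q ^ 2)" if "q > 0" for q :: real
      using that by (simp add: power_add field_simps power2_eq_square)
    have "prob (Bad n) \<le> real (n + 1) ^ d * (2 * exp (- s * (K * sqrt_log_scale n) + real n * s\<^sup>2 * v))"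
      unfolding Bad_def d_def by (rule tail(2)) auto
    also have "\<dots> \<le> (real n + 8) ^ d * (2 * inverse ((real n + 8) ^ (d + 2)))"
      using ex by (intro mult_mono power_mono) auto
    also have "\<dots> = 2 * inverse ((real n + 8) ^ 2)" by (rule qeq) simp
    also have "\<dots> \<le> 2 * inverse (real (Suc n) ^ 2)"
      by (intro mult_left_mono le_imp_inverse_le power_mono) auto
    finally show "prob (Bad n) \<le> 2 * inverse (real (Suc n) ^ 2)" .
  qed
  have "summable (\<lambda>n. 2 * inverse (real (Suc n) ^ 2))"
    using inverse_power_summable[of 2, where 'a=real]
    by (intro summable_mult) (subst summable_Suc_iff, auto)
  then have "summable (\<lambda>n. prob (Bad n))"
    by (rule summable_comparison_test'[where N=0]) (use Bad(2) in auto)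
  then have "AE \<omega> in M. \<forall>\<^sub>F n in sequentially. \<omega> \<in> space M - Bad n"
    using Bad(1) by (intro borel_cantelli_AE1) (auto simp: less_top[symmetric])
  moreover have "AE \<omega> in M. \<exists>C. \<forall>n. (\<Sum>i<n. c i * \<bar>z i (e i \<omega>)\<bar>) \<le> C"
    using truncation_remainder(1)[of e c, OF e same sq] c by (simp add: z_def B_def less_imp_le)
  ultimately show ?thesis
  proof eventually_elim
    case (elim \<omega>)
    then obtain C where C: "\<And>n. (\<Sum>i<n. c i * \<bar>z i (e i \<omega>)\<bar>) \<le> C" by blast
    \<comment> \<open>As \<open>sqrt_log_scale\<close> is nondecreasing, every weight
      \<open>c i\<close> with \<open>i < n\<close> is at least \<open>1 / sqrt_log_scale n\<close>.
      A bounded weighted sum thus gives a plain sum of order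
      \<open>sqrt_log_scale n\<close>.\<close>
    have zb: "(\<Sum>i<n. x i) \<le> (\<Sum>i<n. c i * x i) * sqrt_log_scale n" if "\<And>i. 0 \<le> x i" for x n
    proof -
      have "(\<Sum>i<n. x i) \<le> (\<Sum>i<n. c i * x i * sqrt_log_scale n)"
      proof (rule sum_mono)
        fix i assume "i \<in> {..<n}"
        then have "c i * sqrt_log_scale i \<le> c i * sqrt_log_scale n"
          using sqrt_log_scale_mono[of i n] c[of i] by (intro mult_left_mono) auto
        then have "1 \<le> c i * sqrt_log_scale n"
          using sqrt_log_scale_pos[of i] by (simp add: c_def)
        then have "1 * x i \<le> (c i * sqrt_log_scale n) * x i"
          using that by (intro mult_right_mono) auto
        then show "x i \<le> c i * x i * sqrt_log_scale n" by (simp add: mult_ac)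
      qed
      then show ?thesis by (simp add: sum_distrib_right)
    qed
    have mb: "(\<Sum>i<n. \<bar>m i\<bar>) \<le> v * sqrt_log_scale n" for n
    proof -
      have "(\<Sum>i<n. \<bar>m i\<bar>) \<le> (\<Sum>i<n. c i * \<bar>m i\<bar>) * sqrt_log_scale n" by (rule zb) simp
      also have "\<dots> \<le> (\<Sum>i<n. c i * expectation (\<lambda>\<omega>. \<bar>z i (e i \<omega>)\<bar>)) * sqrt_log_scale n"
        using m_le c sqrt_log_scale_pos[of n]
        by (intro mult_right_mono sum_mono mult_left_mono) (auto simp: less_imp_le)
      also have "\<dots> \<le> v * sqrt_log_scale n"
        using truncation_remainder(2)[of e c n, OF e same sq] c sqrt_log_scale_pos[of n]
        by (intro mult_right_mono) (auto simp: z_def B_def v_def less_imp_le)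
      finally show ?thesis .
    qed
    have "\<forall>\<^sub>F n in sequentially. \<forall>\<gamma> c.
        \<bar>\<Sum>i | i < n \<and> c < \<gamma> \<bullet> X i \<omega>. e i \<omega>\<bar> \<le> (K + v + C) * sqrt_log_scale n"
      using elim(1)
    proof eventually_elim
      case (elim n)
      show ?case
      proof (intro allI)
        fix \<gamma> b
        let ?S = "{i. i < n \<and> b < \<gamma> \<bullet> X i \<omega>}"
        have S: "?S \<subseteq> {..<n}" by auto
        have "?S \<in> halfspace_cuts n (\<lambda>i. X i \<omega>)"
          using halfspace_cut[of n b \<gamma> "\<lambda>i. X i \<omega>"] by simp
        then have gS: "\<bar>\<Sum>i\<in>?S. g i (e i \<omega>)\<bar> \<le> K * sqrt_log_scale n"
          using elim unfolding Bad_def by force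
        \<comment> \<open>The three contributions are the centred truncated noise off the bad event,
          the recentring and the truncation remainder, with constants \<open>K\<close>,
          \<open>v\<close> and \<open>C\<close>.\<close>
        have "(\<Sum>i\<in>?S. e i \<omega>) = (\<Sum>i\<in>?S. g i (e i \<omega>)) + (\<Sum>i\<in>?S. m i) + (\<Sum>i\<in>?S. z i (e i \<omega>))"
          unfolding sum.distrib[symmetric] g_def using split by (intro sum.cong) (auto simp: algebra_simps)
        moreover have "\<bar>\<Sum>i\<in>?S. m i\<bar> \<le> v * sqrt_log_scale n"
          using order_trans[OF sum_abs[of m ?S] sum_mono2[OF finite_lessThan S, of "\<lambda>i. \<bar>m i\<bar>"]] mb[of n]
          by (meson abs_ge_zero order_trans)
        moreover have "\<bar>\<Sum>i\<in>?S. z i (e i \<omega>)\<bar> \<le> C * sqrt_log_scale n"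
        proof -
          have "\<bar>\<Sum>i\<in>?S. z i (e i \<omega>)\<bar> \<le> (\<Sum>i\<in>?S. \<bar>z i (e i \<omega>)\<bar>)" by (rule sum_abs)
          also have "\<dots> \<le> (\<Sum>i<n. \<bar>z i (e i \<omega>)\<bar>)" by (intro sum_mono2 S) auto
          also have "\<dots> \<le> (\<Sum>i<n. c i * \<bar>z i (e i \<omega>)\<bar>) * sqrt_log_scale n" by (rule zb) simp
          also have "\<dots> \<le> C * sqrt_log_scale n"
            using C sqrt_log_scale_pos[of n] by (intro mult_right_mono) auto
          finally show ?thesis .
        qed
        ultimately show "\<bar>\<Sum>i\<in>?S. e i \<omega>\<bar> \<le> (K + v + C) * sqrt_log_scale n"
          using gS by (simp add: algebra_simps abs_le_iff)
      qed
    qed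
    then show ?case by blast
  qed
qed

section \<open>Networks and the penalized estimator\<close>

text \<open>Since \<open>f i + 1\<close> is the length of \<open>{-1<..<f i}\<close>, the sum of
  \<open>w i * (f i + 1)\<close> is the integral of the superlevel sums over an interval of length
  2, hence at most \<open>2 * T\<close> in absolute value; undoing the shift by 1 costs another
  \<open>T\<close>.\<close>

lemma sum_le_if_superlevel_sums_le:
  fixes w f :: "nat \<Rightarrow> real"
  assumes f: "\<And>i. i < n \<Longrightarrow> -1 \<le> f i \<and> f i \<le> 1"
    and T: "\<bar>\<Sum>i<n. w i\<bar> \<le> T"
    and superlevel: "\<And>s. -1 < s \<Longrightarrow> s < 1 \<Longrightarrow> \<bar>\<Sum>i | i < n \<and> s < f i. w i\<bar> \<le> T"
  shows "\<bar>\<Sum>i<n. w i * f i\<bar> \<le> 3 * T"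
proof -
  let ?h = "\<lambda>i s. w i * indicator {-1<..<f i} s"
  have T0: "0 \<le> T" using T by linarith
  have int1: "integrable lborel (\<lambda>s. indicator {-1<..<a} s :: real)" for a :: real
    using emeasure_bounded_finite[of "{-1<..<a}"] by (intro integrable_real_indicator) auto
  have int: "integrable lborel (?h i)" for i
    by (intro integrable_mult_right int1)
  have hi: "(\<integral>s. ?h i s \<partial>lborel) = w i * (f i + 1)" if "i < n" for i
    using f[OF that] by simp
  have "(\<Sum>i<n. w i * (f i + 1)) = (\<Sum>i<n. \<integral>s. ?h i s \<partial>lborel)"
    by (rule sum.cong[OF refl]) (simp only: hi lessThan_iff)
  also have "\<dots> = (\<integral>s. (\<Sum>i<n. ?h i s) \<partial>lborel)"
    using int by (rule Bochner_Integration.integral_sum[symmetric])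
  also have "\<bar>\<dots>\<bar> \<le> (\<integral>s. \<bar>\<Sum>i<n. ?h i s\<bar> \<partial>lborel)"
    by (rule integral_abs_bound)
  also have "\<dots> \<le> (\<integral>s. T * indicator {-1<..<1::real} s \<partial>lborel)"
  proof (rule integral_mono)
    show "integrable lborel (\<lambda>s. \<bar>\<Sum>i<n. ?h i s\<bar>)"
      using int by (intro integrable_abs Bochner_Integration.integrable_sum)
    show "integrable lborel (\<lambda>s. T * indicator {-1<..<1::real} s)"
      by (intro integrable_mult_right int1)
    fix s :: real
    show "\<bar>\<Sum>i<n. ?h i s\<bar> \<le> T * indicator {-1<..<1} s"
    proof (cases "-1 < s \<and> s < 1")
      case True
      have "(\<Sum>i<n. ?h i s) = (\<Sum>i<n. if s < f i then w i else 0)"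
        using True by (intro sum.cong) (auto simp: indicator_def)
      also have "\<dots> = (\<Sum>i | i < n \<and> s < f i. w i)"
        by (subst sum.inter_filter[symmetric]) auto
      finally show ?thesis using True superlevel by simp
    next
      case False
      have "(\<Sum>i<n. ?h i s) = (\<Sum>i<n. 0)"
        using False f by (intro sum.cong) (force simp: indicator_def)+
      then show ?thesis using T0 by simp
    qed
  qed
  also have "\<dots> = 2 * T" by simp
  finally have "\<bar>(\<Sum>i<n. w i * f i) + (\<Sum>i<n. w i)\<bar> \<le> 2 * T"
    by (simp add: distrib_left sum.distrib)
  then show ?thesis using T by linarith
qed

text \<open>As \<open>tanh\<close> is strictly increasing, the superlevel sets of a neuron are
  half-spaces, so each neuron contributes at most \<open>3 * T\<close>; the \<open>l1\<close>-bound
  \<open>V\<close> on the output weights combines the neurons.\<close>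

lemma net_sum_bound:
  fixes x :: "nat \<Rightarrow> real^'d::finite" and w :: "nat \<Rightarrow> real"
  assumes half: "\<And>\<gamma> c. \<bar>\<Sum>i | i < n \<and> c < \<gamma> \<bullet> x i. w i\<bar> \<le> T"
    and \<theta>: "\<theta> \<in> Theta r V M"
  shows "\<bar>\<Sum>i<n. w i * net r \<theta> (x i)\<bar> \<le> V * (3 * T)"
proof -
  obtain \<alpha> \<gamma> \<gamma>0 where th: "\<theta> = (\<alpha>, \<gamma>, \<gamma>0)" by (cases \<theta>)
  \<comment> \<open>Direction 0 with threshold -1 selects every index; in \<open>half\<close> the
    threshold is instantiated before the direction.\<close>
  have full: "\<bar>\<Sum>i<n. w i\<bar> \<le> T"
    using half[of "-1" 0] by (simp add: lessThan_def)
  then have T0: "0 \<le> T" by linarith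
  have neuron: "\<bar>\<Sum>i<n. w i * tanh (\<gamma> j \<bullet> x i + \<gamma>0 j)\<bar> \<le> 3 * T" for j
  proof (rule sum_le_if_superlevel_sums_le[OF _ full])
    fix i show "-1 \<le> tanh (\<gamma> j \<bullet> x i + \<gamma>0 j) \<and> tanh (\<gamma> j \<bullet> x i + \<gamma>0 j) \<le> 1"
      using tanh_real_bounds[of "\<gamma> j \<bullet> x i + \<gamma>0 j"] by auto
  next
    fix s :: real assume s: "-1 < s" "s < 1"
    \<comment> \<open>\<open>a\<close> is the inverse hyperbolic tangent of
      \<open>s\<close>.\<close>
    define a where "a = ln (sqrt ((1 + s) / (1 - s)))"
    have "tanh a = ((1 + s) / (1 - s) - 1) / ((1 + s) / (1 - s) + 1)"
      unfolding a_def using s by (subst tanh_ln_real) auto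
    also have "\<dots> = s" using s by (simp add: field_simps)
    finally have a: "tanh a = s" .
    have "s < tanh (\<gamma> j \<bullet> x i + \<gamma>0 j) \<longleftrightarrow> a - \<gamma>0 j < \<gamma> j \<bullet> x i" for i
      unfolding a[symmetric] tanh_real_less_iff by auto
    then show "\<bar>\<Sum>i | i < n \<and> s < tanh (\<gamma> j \<bullet> x i + \<gamma>0 j). w i\<bar> \<le> T"
      using half[of "a - \<gamma>0 j" "\<gamma> j"] by simp
  qed
  have "(\<Sum>i<n. w i * net r \<theta> (x i))
      = \<alpha> 0 * (\<Sum>i<n. w i) + (\<Sum>i<n. \<Sum>j=1..r. w i * (\<alpha> j * tanh (\<gamma> j \<bullet> x i + \<gamma>0 j)))"
    by (simp add: net_def th distrib_left sum.distrib sum_distrib_left mult_ac)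
  also have "(\<Sum>i<n. \<Sum>j=1..r. w i * (\<alpha> j * tanh (\<gamma> j \<bullet> x i + \<gamma>0 j)))
      = (\<Sum>j=1..r. \<alpha> j * (\<Sum>i<n. w i * tanh (\<gamma> j \<bullet> x i + \<gamma>0 j)))"
    by (subst sum.swap) (simp add: sum_distrib_left mult_ac)
  also have "\<bar>\<alpha> 0 * (\<Sum>i<n. w i) + \<dots>\<bar>
      \<le> \<bar>\<alpha> 0\<bar> * (3 * T) + (\<Sum>j=1..r. \<bar>\<alpha> j\<bar> * (3 * T))"
  proof (rule order_trans[OF abs_triangle_ineq add_mono])
    show "\<bar>\<alpha> 0 * (\<Sum>i<n. w i)\<bar> \<le> \<bar>\<alpha> 0\<bar> * (3 * T)"
      unfolding abs_mult using full T0 by (intro mult_left_mono) auto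
    show "\<bar>\<Sum>j=1..r. \<alpha> j * (\<Sum>i<n. w i * tanh (\<gamma> j \<bullet> x i + \<gamma>0 j))\<bar> \<le> (\<Sum>j=1..r. \<bar>\<alpha> j\<bar> * (3 * T))"
      by (rule order_trans[OF sum_abs sum_mono]) (simp only: abs_mult mult_left_mono[OF neuron] abs_ge_zero)
  qed
  also have "\<dots> = (\<Sum>j\<le>r. \<bar>\<alpha> j\<bar>) * (3 * T)"
    by (simp add: sum_distrib_right atMost_atLeast0 sum.atLeast_Suc_atMost distrib_right)
  also have "\<dots> \<le> V * (3 * T)"
    using \<theta> T0 by (intro mult_right_mono) (auto simp: Theta_def th)
  finally show ?thesis .
qed

text \<open>The logarithm in the rate condition can be far smaller than \<open>ln n\<close>, hence
  the case split. If \<open>V n ^ 4 \<le> n\<close>, then \<open>(V n)^2 * ln n / n\<close> is at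
  most \<open>ln n / sqrt n\<close>; otherwise \<open>ln n \<le> 4 * ln (V n)\<close>, which the
  rate condition does control.\<close>

lemma weight_bound_sqrt_log_scale_tendsto_0:
  fixes r :: "nat \<Rightarrow> nat" and V :: "nat \<Rightarrow> real"
  assumes r: "filterlim r at_top sequentially" and V: "\<And>n. V n > 1"
    and rate: "(\<lambda>n. real (r n) * (V n)\<^sup>2 * ln (real (r n) * V n)) \<in> o(\<lambda>n. real n)"
  shows "(\<lambda>n. V n * sqrt_log_scale n / real n) \<longlonglongrightarrow> 0"
proof -
  let ?R = "\<lambda>n. real (r n) * (V n)\<^sup>2 * ln (real (r n) * V n) / real n"
  have R: "?R \<longlonglongrightarrow> 0"
    using smalloD_tendsto[OF rate] .
  have "\<forall>\<^sub>F n in sequentially. (V n)\<^sup>2 * ln n / n \<le> ln n / sqrt n + 4 * ?R n"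
  proof -
    have "\<forall>\<^sub>F n in sequentially. 1 \<le> r n"
      using r by (simp add: filterlim_at_top)
    then show ?thesis
      using eventually_ge_at_top[of 1]
    proof eventually_elim
      case (elim n)
      have V0: "0 < V n" and lnn: "0 \<le> ln (real n)" using V[of n] elim by auto
      have lnr: "ln (V n) \<le> ln (real (r n) * V n)"
        using elim V0 by (subst ln_le_cancel_iff) auto
      have lnV: "0 < ln (V n)" using V[of n] by simp
      have R0: "0 \<le> ?R n" using lnr lnV elim by (intro divide_nonneg_nonneg mult_nonneg_nonneg) auto
      show ?case
      proof (cases "V n ^ 4 \<le> real n")
        case True
        have "(V n)\<^sup>2 \<le> sqrt (real n)"
          using True by (intro real_le_rsqrt) simp
        then have "(V n)\<^sup>2 * ln n / n \<le> sqrt (real n) * ln n / n"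
          using lnn by (intro divide_right_mono mult_right_mono) auto
        also have "\<dots> = ln n / sqrt n"
          using elim by (simp add: field_simps)
        finally show ?thesis using R0 by linarith
      next
        case False
        then have "ln (real n) \<le> ln (V n ^ 4)"
          using elim V0 by (subst ln_le_cancel_iff) auto
        also have "\<dots> = 4 * ln (V n)" using V0 by (simp add: ln_realpow)
        also have "\<dots> \<le> real (r n) * (4 * ln (real (r n) * V n))"
          using elim lnr lnV mult_mono[of 1 "real (r n)" "4 * ln (V n)" "4 * ln (real (r n) * V n)"] by simp
        finally have "(V n)\<^sup>2 * ln n / n \<le> (V n)\<^sup>2 * (real (r n) * (4 * ln (real (r n) * V n))) / n"
          by (intro divide_right_mono mult_left_mono) auto
        also have "\<dots> = 4 * ?R n" by simp
        finally show ?thesis using lnn by (simp add: add_increasing)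
      qed
    qed
  qed
  moreover have "(\<lambda>n. ln (real n) / sqrt (real n)) \<longlonglongrightarrow> 0"
    by real_asymp
  then have "(\<lambda>n. ln n / sqrt n + 4 * ?R n) \<longlonglongrightarrow> 0 + 4 * 0"
    using R by (intro tendsto_add tendsto_mult tendsto_const)
  moreover have "\<forall>\<^sub>F n in sequentially. 0 \<le> (V n)\<^sup>2 * ln n / n"
    using eventually_ge_at_top[of 1] by eventually_elim simp
  ultimately have lim: "(\<lambda>n. (V n)\<^sup>2 * ln n / n) \<longlonglongrightarrow> 0"
    by (intro tendsto_sandwich[of "\<lambda>_. 0" "\<lambda>n. (V n)\<^sup>2 * ln n / n" _ "\<lambda>n. ln n / sqrt n + 4 * ?R n"]) auto
  \<comment> \<open>The square of the claimed sequence is \<open>(V n)^2 / n\<close> times the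
    quotient bounded here, so the limit \<open>lim\<close> applies up to the factor 4.\<close>
  have "\<forall>\<^sub>F n in sequentially. (real n + 1) * ln (real n + 8) / real n \<le> 4 * ln (real n)"
    by real_asymp
  then have "\<forall>\<^sub>F n in sequentially. (V n * sqrt_log_scale n / real n)\<^sup>2 \<le> 4 * ((V n)\<^sup>2 * ln n / n)"
    using eventually_ge_at_top[of 1]
  proof eventually_elim
    case (elim n)
    have "(V n * sqrt_log_scale n / real n)\<^sup>2 = (V n)\<^sup>2 / real n * ((real n + 1) * ln (real n + 8) / real n)"
      using ln_add_8_ge_2[of n] by (simp add: sqrt_log_scale_def power_divide power_mult_distrib power2_eq_square[of "real n"])
    also have "\<dots> \<le> (V n)\<^sup>2 / real n * (4 * ln (real n))"
      using elim by (intro mult_left_mono) auto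
    finally show ?case by (simp add: mult_ac)
  qed
  moreover have "(\<lambda>n. 4 * ((V n)\<^sup>2 * ln n / n)) \<longlonglongrightarrow> 4 * 0"
    by (intro tendsto_mult lim tendsto_const)
  ultimately have "(\<lambda>n. (V n * sqrt_log_scale n / real n)\<^sup>2) \<longlonglongrightarrow> 0"
    by (intro tendsto_sandwich[of "\<lambda>_. 0" "\<lambda>n. (V n * sqrt_log_scale n / real n)\<^sup>2" _ "\<lambda>n. 4 * ((V n)\<^sup>2 * ln n / n)"]) auto
  then have "(\<lambda>n. sqrt ((V n * sqrt_log_scale n / real n)\<^sup>2)) \<longlonglongrightarrow> sqrt 0"
    by (rule tendsto_real_sqrt)
  then show ?thesis by (simp only: real_sqrt_abs real_sqrt_zero tendsto_rabs_zero_iff)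
qed

text \<open>Appended zero neurons change neither the function nor the penalty. A single
  \<open>\<theta>'\<close> serves every \<open>r' \<ge> r\<close>, so its penalty stays constant
  along the sequence; \<open>0 \<le> M'\<close> admits the zero neurons into the class.\<close>

lemma Theta_pad:
  fixes \<theta> :: "'d::finite nnparam"
  assumes \<theta>: "\<theta> \<in> Theta r V M"
  obtains \<theta>' :: "'d nnparam" where
    "\<And>r'. r \<le> r' \<Longrightarrow> net r' \<theta>' = net r \<theta>"
    "\<And>r'. r \<le> r' \<Longrightarrow> Jpen r' \<theta>' = Jpen r \<theta>"
    "\<And>r' V' M'. r \<le> r' \<Longrightarrow> V \<le> V' \<Longrightarrow> M \<le> M' \<Longrightarrow> 0 \<le> M' \<Longrightarrow> \<theta>' \<in> Theta r' V' M'"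
proof -
  obtain \<alpha> \<gamma> \<gamma>0 where th: "\<theta> = (\<alpha>, \<gamma>, \<gamma>0)" by (cases \<theta>)
  define \<theta>' where "\<theta>' = (\<lambda>j. if j \<le> r then \<alpha> j else 0, \<lambda>j. if j \<le> r then \<gamma> j else 0,
    \<lambda>j. if j \<le> r then \<gamma>0 j else 0)"
  have extend: "(\<Sum>j=1..r'. f j) = (\<Sum>j=1..r. g j)"
    if "r \<le> r'" "\<And>j. j \<le> r \<Longrightarrow> f j = g j" "\<And>j. r < j \<Longrightarrow> f j = 0" for r' and f g :: "nat \<Rightarrow> real"
    using that by (intro sum.mono_neutral_cong_right) auto
  have extend0: "(\<Sum>j\<le>r'. f j) = (\<Sum>j\<le>r. g j)"
    if "r \<le> r'" "\<And>j. j \<le> r \<Longrightarrow> f j = g j" "\<And>j. r < j \<Longrightarrow> f j = 0" for r' and f g :: "nat \<Rightarrow> real"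
    using that by (intro sum.mono_neutral_cong_right) auto
  show thesis
  proof (rule that)
    fix r' assume r': "r \<le> r'"
    show "net r' \<theta>' = net r \<theta>"
    proof
      fix x
      show "net r' \<theta>' x = net r \<theta> x"
        unfolding net_def th \<theta>'_def prod.case by (subst extend[OF r']) auto
    qed
    show "Jpen r' \<theta>' = Jpen r \<theta>"
      unfolding Jpen_def th \<theta>'_def prod.case
      by (intro arg_cong2[where f = "(+)"] extend[OF r'] extend0[OF r']) auto
    fix V' M' :: real assume le: "V \<le> V'" "M \<le> M'" "0 \<le> M'"
    have "(\<Sum>j\<le>r'. \<bar>if j \<le> r then \<alpha> j else 0\<bar>) = (\<Sum>j\<le>r. \<bar>\<alpha> j\<bar>)"
      by (rule extend0[OF r']) auto
    moreover have "(\<Sum>j\<le>r. \<bar>\<alpha> j\<bar>) \<le> V'"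
      and "j \<in> {1..r} \<Longrightarrow> \<bar>\<gamma>0 j\<bar> + (\<Sum>i\<in>UNIV. \<bar>\<gamma> j $ i\<bar>) \<le> M'" for j
      using \<theta> le by (auto simp: Theta_def th intro: order_trans)
    ultimately show "\<theta>' \<in> Theta r' V' M'"
      using le(3) by (auto simp: Theta_def \<theta>'_def)
  qed
qed

section \<open>Deterministic analysis of the penalized estimator\<close>

lemma Jpen_nonneg: "0 \<le> Jpen r \<theta>"
  unfolding Jpen_def by (cases \<theta>) (auto intro!: add_nonneg_nonneg sum_nonneg)

lemma Qpen_nonneg: "0 \<le> lam \<Longrightarrow> 0 \<le> Qpen n r lam x y \<theta>"
  unfolding Qpen_def using Jpen_nonneg[of r \<theta>]
  by (intro add_nonneg_nonneg mult_nonneg_nonneg sum_nonneg) auto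

text \<open>Near-optimality of \<open>\<theta>\<close> against the competitor
  \<open>\<theta>'\<close>, after expanding the squares, leaves twice the noise sum of each of the
  two networks. Each sum is at most \<open>3 * (V * T)\<close> in absolute value, which gives the
  factor 12.\<close>

lemma penalized_basic_inequality:
  fixes x :: "nat \<Rightarrow> real^'d::finite" and e :: "nat \<Rightarrow> real"
  assumes n: "0 < n" and lam: "0 \<le> lam"
    and half: "\<And>\<gamma> c. \<bar>\<Sum>i | i < n \<and> c < \<gamma> \<bullet> x i. e i\<bar> \<le> T"
    and \<theta>: "\<theta> \<in> Theta r V M" and \<theta>': "\<theta>' \<in> Theta r V M"
    and opt: "Qpen n r lam x (\<lambda>i. f0 (x i) + e i) \<theta>
      \<le> (INF \<theta>\<in>Theta r V M. Qpen n r lam x (\<lambda>i. f0 (x i) + e i) \<theta>) + h"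
    and close: "\<And>i. \<bar>net r \<theta>' (x i) - f0 (x i)\<bar> \<le> b"
  shows "(emp_norm n x (\<lambda>x. net r \<theta> x - f0 x))\<^sup>2
      \<le> b\<^sup>2 + 12 * (V * T / n) + lam * Jpen r \<theta>' + h"
proof -
  let ?f = "\<lambda>i. net r \<theta> (x i)" and ?g = "\<lambda>i. net r \<theta>' (x i)" and ?a = "\<lambda>i. f0 (x i)"
  define Sf where "Sf = (\<Sum>i<n. (?f i - (?a i + e i))\<^sup>2)"
  define Sg where "Sg = (\<Sum>i<n. (?g i - (?a i + e i))\<^sup>2)"
  \<comment> \<open>A real infimum is known to lie below the members of a set only if the set is
    bounded below; here 0 is a lower bound.\<close>
  have "bdd_below ((\<lambda>\<theta>. Qpen n r lam x (\<lambda>i. f0 (x i) + e i) \<theta>) ` Theta r V M)"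
    using Qpen_nonneg[OF lam] by (intro bdd_belowI2)
  then have "(INF \<theta>\<in>Theta r V M. Qpen n r lam x (\<lambda>i. f0 (x i) + e i) \<theta>)
      \<le> Qpen n r lam x (\<lambda>i. f0 (x i) + e i) \<theta>'"
    using \<theta>' by (rule cINF_lower)
  with opt have "Sf / n + lam * Jpen r \<theta> \<le> Sg / n + lam * Jpen r \<theta>' + h"
    by (simp add: Qpen_def Sf_def Sg_def)
  moreover have "0 \<le> lam * Jpen r \<theta>" by (rule mult_nonneg_nonneg[OF lam Jpen_nonneg])
  ultimately have opt': "Sf / n \<le> Sg / n + lam * Jpen r \<theta>' + h" by linarith
  have "(\<Sum>i<n. (?f i - ?a i)\<^sup>2) = (\<Sum>i<n. (?f i - (?a i + e i))\<^sup>2 - (?g i - (?a i + e i))\<^sup>2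
      + (?g i - ?a i)\<^sup>2 + 2 * (e i * ?f i) - 2 * (e i * ?g i))"
    by (intro sum.cong) (auto simp: power2_eq_square algebra_simps)
  also have "\<dots> = Sf - Sg + (\<Sum>i<n. (?g i - ?a i)\<^sup>2) + 2 * (\<Sum>i<n. e i * ?f i) - 2 * (\<Sum>i<n. e i * ?g i)"
    by (simp add: sum.distrib sum_subtractf sum_distrib_left Sf_def Sg_def)
  also have "\<dots> \<le> Sf - Sg + n * b\<^sup>2 + 12 * (V * T)"
  proof -
    have "(?g i - ?a i)\<^sup>2 \<le> b\<^sup>2" for i
      using power_mono[OF close[of i], of 2] by simp
    then have "(\<Sum>i<n. (?g i - ?a i)\<^sup>2) \<le> (\<Sum>i<n. b\<^sup>2)" by (intro sum_mono)
    then show ?thesis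
      using net_sum_bound[OF half \<theta>] net_sum_bound[OF half \<theta>'] by (simp add: abs_le_iff)
  qed
  finally have "(\<Sum>i<n. (?f i - ?a i)\<^sup>2) / n \<le> (Sf - Sg + n * b\<^sup>2 + 12 * (V * T)) / n"
    by (intro divide_right_mono) auto
  also have "\<dots> = Sf / n - Sg / n + b\<^sup>2 + 12 * (V * T / n)"
    using n by (simp add: add_divide_distrib diff_divide_distrib)
  also have "\<dots> \<le> b\<^sup>2 + 12 * (V * T / n) + lam * Jpen r \<theta>' + h"
    using opt' by linarith
  finally show ?thesis
    by (simp add: emp_norm_def sum_nonneg)
qed

text \<open>The competitor is one approximant \<open>\<pi>f m\<close> within
  \<open>b = \<epsilon> / 2\<close> of \<open>f0\<close>, padded to all larger widths. With
  \<open>m\<close> fixed its penalty is \<open>lam n\<close> times a constant and vanishes, whereas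
  the penalty factor of \<open>\<pi>f n\<close> could grow with \<open>n\<close>. The upper bound
  then tends to \<open>b^2 < \<epsilon>^2\<close>.\<close>

lemma penalized_estimator_tendsto:
  fixes x :: "nat \<Rightarrow> real^'d::finite" and e :: "nat \<Rightarrow> real"
  assumes half: "\<forall>\<^sub>F n in sequentially. \<forall>\<gamma> c. \<bar>\<Sum>i | i < n \<and> c < \<gamma> \<bullet> x i. e i\<bar> \<le> C * sqrt_log_scale n"
    and x: "\<And>i. x i \<in> \<X>"
    and r: "filterlim r at_top sequentially" and V: "filterlim V at_top sequentially"
    and Mn: "filterlim Mn at_top sequentially"
    and approx: "\<And>n. \<pi>f n \<in> Fclass (r n) (V n) (Mn n)"
      "\<And>b. b > 0 \<Longrightarrow> \<forall>\<^sub>F n in sequentially. \<forall>x\<in>\<X>. \<bar>\<pi>f n x - f0 x\<bar> < b"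
    and rate: "(\<lambda>n. V n * sqrt_log_scale n / real n) \<longlonglongrightarrow> 0"
    and lam: "\<And>n. 0 \<le> lam n" "lam \<longlonglongrightarrow> 0" and h: "h \<longlonglongrightarrow> 0"
    and \<theta>: "\<And>n. \<theta> n \<in> Theta (r n) (V n) (Mn n)"
    and opt: "\<forall>\<^sub>F n in sequentially. Qpen n (r n) (lam n) x (\<lambda>i. f0 (x i) + e i) (\<theta> n)
      \<le> (INF \<theta>\<in>Theta (r n) (V n) (Mn n). Qpen n (r n) (lam n) x (\<lambda>i. f0 (x i) + e i) \<theta>) + h n"
  shows "(\<lambda>n. emp_norm n x (\<lambda>x. net (r n) (\<theta> n) x - f0 x)) \<longlonglongrightarrow> 0"
proof (rule LIMSEQ_I)
  fix \<epsilon> :: real assume \<epsilon>: "0 < \<epsilon>"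
  define b where "b = \<epsilon> / 2"
  have b: "0 < b" "b\<^sup>2 < \<epsilon>\<^sup>2" using \<epsilon> by (auto simp: b_def power_divide)
  obtain m where m: "\<forall>x\<in>\<X>. \<bar>\<pi>f m x - f0 x\<bar> < b"
    using approx(2)[OF b(1)] by (auto simp: eventually_sequentially)
  obtain \<theta>m where \<theta>m: "\<theta>m \<in> Theta (r m) (V m) (Mn m)" "\<pi>f m = net (r m) \<theta>m"
    using approx(1)[of m] by (auto simp: Fclass_def)
  obtain \<theta>' where \<theta>': "\<And>r'. r m \<le> r' \<Longrightarrow> net r' \<theta>' = net (r m) \<theta>m"
    "\<And>r'. r m \<le> r' \<Longrightarrow> Jpen r' \<theta>' = Jpen (r m) \<theta>m"
    "\<And>r' V' M'. r m \<le> r' \<Longrightarrow> V m \<le> V' \<Longrightarrow> Mn m \<le> M' \<Longrightarrow> 0 \<le> M' \<Longrightarrow> \<theta>' \<in> Theta r' V' M'"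
    using Theta_pad[OF \<theta>m(1)] by blast
  let ?D = "\<lambda>n. emp_norm n x (\<lambda>x. net (r n) (\<theta> n) x - f0 x)"
  let ?U = "\<lambda>n. b\<^sup>2 + 12 * (C * (V n * sqrt_log_scale n / n)) + lam n * Jpen (r m) \<theta>m + h n"
  \<comment> \<open>The maximum with 0 secures the nonnegative input bound that padding
    requires.\<close>
  have "\<forall>\<^sub>F n in sequentially. r m \<le> r n" "\<forall>\<^sub>F n in sequentially. V m \<le> V n"
    "\<forall>\<^sub>F n in sequentially. max 0 (Mn m) \<le> Mn n"
    using r V Mn unfolding filterlim_at_top by blast+
  then have le: "\<forall>\<^sub>F n in sequentially. (?D n)\<^sup>2 \<le> ?U n"
    using half opt eventually_gt_at_top[of 0]
  proof eventually_elim
    case (elim n)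
    have "(?D n)\<^sup>2 \<le> b\<^sup>2 + 12 * (V n * (C * sqrt_log_scale n) / n) + lam n * Jpen (r n) \<theta>' + h n"
    proof (rule penalized_basic_inequality)
      show "\<theta>' \<in> Theta (r n) (V n) (Mn n)"
        using elim by (intro \<theta>'(3)) auto
      show "\<bar>net (r n) \<theta>' (x i) - f0 (x i)\<bar> \<le> b" for i
        using m x[of i] \<theta>'(1)[OF elim(1)] \<theta>m(2) by (auto simp: less_imp_le)
    qed (use elim lam(1) \<theta> in auto)
    then show ?case
      using \<theta>'(2)[OF elim(1)] by (simp add: mult_ac)
  qed
  have "?U \<longlonglongrightarrow> b\<^sup>2 + 12 * (C * 0) + 0 * Jpen (r m) \<theta>m + 0"
    by (intro tendsto_intros rate lam(2) h)
  then have "\<forall>\<^sub>F n in sequentially. ?U n < \<epsilon>\<^sup>2"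
    using b(2) by (intro order_tendstoD) auto
  with le have "\<forall>\<^sub>F n in sequentially. norm (?D n - 0) < \<epsilon>"
  proof eventually_elim
    case (elim n)
    then have "\<bar>?D n\<bar>\<^sup>2 < \<epsilon>\<^sup>2" by simp
    then have "\<bar>?D n\<bar> < \<epsilon>" by (rule power2_less_imp_less) (use \<epsilon> in simp)
    then show ?case by simp
  qed
  then show "\<exists>n0. \<forall>n\<ge>n0. norm (?D n - 0) < \<epsilon>"
    by (simp add: eventually_sequentially)
qed

theorem theorem4:
  fixes M :: "'a measure"
    and X :: "nat \<Rightarrow> 'a \<Rightarrow> real^'d::finite"
    and eps :: "nat \<Rightarrow> 'a \<Rightarrow> real"
    and P :: "(real^'d) measure" and E :: "real measure"
    and \<X> :: "(real^'d) set"
    and f0 :: "real^'d \<Rightarrow> real"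
    and p :: real
    and r :: "nat \<Rightarrow> nat" and V Mn \<eta> :: "nat \<Rightarrow> real"
    and \<delta> :: real
  assumes prob: "prob_space M"
    and indep: "prob_space.indep_vars M (\<lambda>_. borel) (\<lambda>i \<omega>. (X i \<omega>, eps i \<omega>)) UNIV"
    and indep_XE: "\<And>i. distr M borel (\<lambda>\<omega>. (X i \<omega>, eps i \<omega>)) = P \<Otimes>\<^sub>M E"
    and X_meas: "\<And>i. X i \<in> borel_measurable M"
    and eps_meas: "\<And>i. eps i \<in> borel_measurable M"
    and X_distr: "\<And>i. distr M borel (X i) = P"
    and eps_distr: "\<And>i. distr M borel (eps i) = E"
    and compact: "compact \<X>"
    and support: "\<And>i. AE \<omega> in M. X i \<omega> \<in> \<X>"
    and eps_int: "integrable M (eps 0)"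
    and eps_mean: "(\<integral>\<omega>. eps 0 \<omega> \<partial>M) = 0"
    and p_ge: "p \<ge> 2"
    and tail: "(\<integral>\<^sup>+ t. indicator {0..} t *
                 ennreal ((measure M {\<omega>\<in>space M. \<bar>eps 0 \<omega>\<bar> > t}) powr (1 / p)) \<partial>lborel) < \<infinity>"
    and r_inf: "filterlim r at_top sequentially"
    and V_inf: "filterlim V at_top sequentially"
    and M_inf: "filterlim Mn at_top sequentially"
    and V_gt: "\<And>n. V n > 1"
    and M_gt: "\<And>n. Mn n > 0"
    and nested: "\<And>n. (Fclass (r n) (V n) (Mn n) :: (real^'d \<Rightarrow> real) set)
                     \<subseteq> Fclass (r (Suc n)) (V (Suc n)) (Mn (Suc n))"
    and approx: "\<exists>\<pi>f :: nat \<Rightarrow> real^'d \<Rightarrow> real.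
                   (\<forall>n. \<pi>f n \<in> Fclass (r n) (V n) (Mn n)) \<and>
                   (\<forall>e>0. eventually (\<lambda>n. \<forall>x\<in>\<X>. \<bar>\<pi>f n x - f0 x\<bar> < e) sequentially)"
    and eta_lim: "\<eta> \<longlonglongrightarrow> 0"
    and rate: "(\<lambda>n. real (r n) * (V n)^2 * ln (real (r n) * V n)) \<in> o(\<lambda>n. real n)"
    and delta_pos: "\<delta> > 0"
  shows "\<exists>\<nu>>0. \<forall>(lam :: nat \<Rightarrow> real) (\<theta>hat :: nat \<Rightarrow> 'a \<Rightarrow> 'd nnparam).
      (\<forall>n. lam n \<ge> 0) \<longrightarrow>
      lam \<in> o(\<lambda>n. min (real (r n) powr (-1/2)) (real (r n) powr (-(\<nu> - 1) / (2 * \<nu>)))) \<longrightarrow>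
      (\<forall>n. \<forall>\<omega>\<in>space M. \<theta>hat n \<omega> \<in> Theta (r n) (V n) (Mn n)) \<longrightarrow>
      (\<exists>C N. \<forall>n\<ge>N. \<forall>\<omega>\<in>space M.
          Qpen n (r n) (lam n) (\<lambda>i. X i \<omega>) (\<lambda>i. f0 (X i \<omega>) + eps i \<omega>) (\<theta>hat n \<omega>)
          \<le> (INF \<theta>\<in>Theta (r n) (V n) (Mn n).
               Qpen n (r n) (lam n) (\<lambda>i. X i \<omega>) (\<lambda>i. f0 (X i \<omega>) + eps i \<omega>) \<theta>) + C * \<eta> n) \<longrightarrow>
      (\<exists>A\<in>sets M. measure M A \<ge> 1 - \<delta> \<and>
         (\<forall>\<omega>\<in>A. (\<lambda>n. emp_norm n (\<lambda>i. X i \<omega>) (\<lambda>x. net (r n) (\<theta>hat n \<omega>) x - f0 x))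
                    \<longlonglongrightarrow> 0))"
proof -
  interpret prob_space M by (rule prob)
  have sq: "integrable M (\<lambda>\<omega>. (eps 0 \<omega>)\<^sup>2)"
    using eps_meas p_ge tail by (rule integrable_square_if_tail)
  have "AE \<omega> in M. \<exists>C. \<forall>\<^sub>F n in sequentially. \<forall>\<gamma> c.
      \<bar>\<Sum>i | i < n \<and> c < \<gamma> \<bullet> X i \<omega>. eps i \<omega>\<bar> \<le> C * sqrt_log_scale n"
    by (rule halfspace_sums_AE_bound[OF indep X_meas eps_meas _ _ eps_int eps_mean sq])
       (simp_all only: indep_XE X_distr eps_distr)
  moreover have "AE \<omega> in M. \<forall>i. X i \<omega> \<in> \<X>"
    using support by (simp add: AE_all_countable)
  ultimately have "AE \<omega> in M. (\<exists>C. \<forall>\<^sub>F n in sequentially. \<forall>\<gamma> c.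
      \<bar>\<Sum>i | i < n \<and> c < \<gamma> \<bullet> X i \<omega>. eps i \<omega>\<bar> \<le> C * sqrt_log_scale n) \<and> (\<forall>i. X i \<omega> \<in> \<X>)"
    by eventually_elim simp
  \<comment> \<open>The null set is fixed before the penalty and the estimator, so its complement
    serves all of them, and measurability of the set where the estimator converges never
    arises.\<close>
  then obtain N where N: "N \<in> null_sets M"
    and good: "\<And>\<omega>. \<omega> \<in> space M - N \<Longrightarrow> (\<exists>C. \<forall>\<^sub>F n in sequentially. \<forall>\<gamma> c.
      \<bar>\<Sum>i | i < n \<and> c < \<gamma> \<bullet> X i \<omega>. eps i \<omega>\<bar> \<le> C * sqrt_log_scale n) \<and> (\<forall>i. X i \<omega> \<in> \<X>)"
    unfolding eventually_ae_filter by blast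
  have full: "space M - N \<in> sets M" "1 - \<delta> \<le> prob (space M - N)"
    using N prob_compl[of N] measure_eq_0_null_sets[OF N] delta_pos by (auto simp: null_setsD2)
  note Vrate = weight_bound_sqrt_log_scale_tendsto_0[OF r_inf V_gt rate]
  obtain \<pi>f :: "nat \<Rightarrow> real^'d \<Rightarrow> real" where \<pi>f: "\<And>n. \<pi>f n \<in> Fclass (r n) (V n) (Mn n)"
      "\<And>b. b > 0 \<Longrightarrow> \<forall>\<^sub>F n in sequentially. \<forall>x\<in>\<X>. \<bar>\<pi>f n x - f0 x\<bar> < b"
    using approx by blast
  \<comment> \<open>With \<open>\<nu> = 1\<close> the second exponent is 0, so the minimum is at
    most 1 and the condition on \<open>lam\<close> yields
    \<open>lam \<longlonglongrightarrow> 0\<close>.\<close>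
  show ?thesis
  proof (intro exI[of _ 1] conjI allI impI)
    fix lam :: "nat \<Rightarrow> real" and \<theta>hat :: "nat \<Rightarrow> 'a \<Rightarrow> 'd nnparam"
    assume lam0: "\<forall>n. 0 \<le> lam n"
      and lam: "lam \<in> o(\<lambda>n. min (real (r n) powr (- 1 / 2)) (real (r n) powr (- (1 - 1) / (2 * 1))))"
      and \<theta>hat: "\<forall>n. \<forall>\<omega>\<in>space M. \<theta>hat n \<omega> \<in> Theta (r n) (V n) (Mn n)"
      and opt: "\<exists>C N. \<forall>n\<ge>N. \<forall>\<omega>\<in>space M.
          Qpen n (r n) (lam n) (\<lambda>i. X i \<omega>) (\<lambda>i. f0 (X i \<omega>) + eps i \<omega>) (\<theta>hat n \<omega>)
          \<le> (INF \<theta>\<in>Theta (r n) (V n) (Mn n).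
               Qpen n (r n) (lam n) (\<lambda>i. X i \<omega>) (\<lambda>i. f0 (X i \<omega>) + eps i \<omega>) \<theta>) + C * \<eta> n"
    obtain C N0 where C: "\<And>n \<omega>. n \<ge> N0 \<Longrightarrow> \<omega> \<in> space M \<Longrightarrow>
          Qpen n (r n) (lam n) (\<lambda>i. X i \<omega>) (\<lambda>i. f0 (X i \<omega>) + eps i \<omega>) (\<theta>hat n \<omega>)
          \<le> (INF \<theta>\<in>Theta (r n) (V n) (Mn n).
               Qpen n (r n) (lam n) (\<lambda>i. X i \<omega>) (\<lambda>i. f0 (X i \<omega>) + eps i \<omega>) \<theta>) + C * \<eta> n"
      using opt by blast
    have "(\<lambda>n. min (real (r n) powr (- 1 / 2)) (real (r n) powr (- (1 - 1) / (2 * 1)))) \<in> O(\<lambda>_. 1)"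
    proof (rule bigoI[of _ 1])
      show "\<forall>\<^sub>F n in sequentially.
          norm (min (real (r n) powr (- 1 / 2)) (real (r n) powr (- (1 - 1) / (2 * 1)))) \<le> 1 * norm (1::real)"
        by (auto simp: min_def)
    qed
    with lam have "lam \<in> o(\<lambda>_. 1)" by (rule landau_o.small_big_trans)
    then have lam1: "lam \<longlonglongrightarrow> 0" using smalloD_tendsto by fastforce
    have h: "(\<lambda>n. C * \<eta> n) \<longlonglongrightarrow> 0"
      using tendsto_mult_right_zero[OF eta_lim] by simp
    show "\<exists>A\<in>sets M. 1 - \<delta> \<le> prob A \<and>
         (\<forall>\<omega>\<in>A. (\<lambda>n. emp_norm n (\<lambda>i. X i \<omega>) (\<lambda>x. net (r n) (\<theta>hat n \<omega>) x - f0 x)) \<longlonglongrightarrow> 0)"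
    proof (intro bexI[OF _ full(1)] conjI ballI full(2))
      fix \<omega> assume \<omega>: "\<omega> \<in> space M - N"
      then obtain K where K: "\<forall>\<^sub>F n in sequentially. \<forall>\<gamma> c.
          \<bar>\<Sum>i | i < n \<and> c < \<gamma> \<bullet> X i \<omega>. eps i \<omega>\<bar> \<le> K * sqrt_log_scale n" and X: "\<And>i. X i \<omega> \<in> \<X>"
        using good by blast
      show "(\<lambda>n. emp_norm n (\<lambda>i. X i \<omega>) (\<lambda>x. net (r n) (\<theta>hat n \<omega>) x - f0 x)) \<longlonglongrightarrow> 0"
      proof (rule penalized_estimator_tendsto[OF K X r_inf V_inf M_inf \<pi>f Vrate _ lam1 h])
        show "\<forall>\<^sub>F n in sequentially.
            Qpen n (r n) (lam n) (\<lambda>i. X i \<omega>) (\<lambda>i. f0 (X i \<omega>) + eps i \<omega>) (\<theta>hat n \<omega>)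
            \<le> (INF \<theta>\<in>Theta (r n) (V n) (Mn n).
                 Qpen n (r n) (lam n) (\<lambda>i. X i \<omega>) (\<lambda>i. f0 (X i \<omega>) + eps i \<omega>) \<theta>) + C * \<eta> n"
          using C \<omega> by (auto simp: eventually_sequentially)
      qed (use lam0 \<theta>hat \<omega> in auto)
    qed
  qed simp
qed

end
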